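(* For every $x\in\mathcal{P}_c$ one has $\varphi(x)=a(x)$; that is, the bijection $\varphi:\mathcal{P}_c\rightarrow\mathcal{W}_f$ characterized by $(J_{\varphi(x)},I_{\varphi(x)})=(D_x,U_x[-1])$ for all $x\in\mathcal{P}_c$, and Zinno's bijection $a:\mathcal{P}_c\rightarrow\mathcal{W}_f$, $x\mapsto w_x$, are the same.
   Context: Let $n\ge 1$, $\mathcal{W}=\mathfrak{S}_{n+1}$, $s_i=(i,i+1)$, $\mathcal{S}=\{s_1,\dots,s_n\}$, $\mathcal{T}$ the set of all transpositions; $\ell_{\mathcal{S}}$ and $\ell_{\mathcal{T}}$ are the word lengths with respect to $\mathcal{S}$ and $\mathcal{T}$. Permutations are composed from right to left, so $c:=s_1s_2\cdots s_n=(1,2,\dots,n+1)$. For $A\subset\mathbb{Z}$ and $m\in\mathbb{Z}$, $A[m]:=\{a+m\mid a\in A\}$. Fully commutative elements: $w\in\mathcal{W}$ is fully commutative if any two reduced $\mathcal{S}$-decompositions of $w$ are related by a sequence of relations $st=ts$ with $s,t\in\mathcal{S}$. $\mathcal{W}_f$ is the set of fully commutative elements. Every $w\in\mathcal{W}_f$ has a unique reduced $\mathcal{S}$-decomposition of the form $(s_{i_1}s_{i_1-1}\cdots s_{j_1})(s_{i_2}s_{i_2-1}\cdots s_{j_2})\cdots(s_{i_\ell}s_{i_\ell-1}\cdots s_{j_\ell})$ with all indices in $\{1,\dots,n\}$, $i_1<\dots<i_\ell$, $j_1<\dots<j_\ell$, $j_m\le i_m$ for all $m$. Set $I_w:=\{i_1,\dots,i_\ell\}$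 and $J_w:=\{j_1,\dots,j_\ell\}$. Noncrossing partitions: $u<_{\mathcal{T}}v$ means $\ell_{\mathcal{T}}(u)+\ell_{\mathcal{T}}(u^{-1}v)=\ell_{\mathcal{T}}(v)$ (equality allowed), and $\mathcal{P}_c:=\{x\in\mathcal{W}\mid x<_{\mathcal{T}}c\}$. Each $x\in\mathcal{P}_c$ is a product of disjoint cycles $(i_1,i_2,\dots,i_k)$ with $i_1<\dots<i_k$ whose supports are the non-singleton blocks of a noncrossing partition of $\{1,\dots,n+1\}$; each such cycle with $k\ge2$ is represented by a polygon $[i_1\cdots i_k]$ with initial vertex $i_1$ and terminal vertex $i_k$. Let $\mathrm{Vert}(x)$ be the set of vertices of all polygons of $x$, $U_x:=\mathrm{Vert}(x)\setminus\{\text{initial vertices}\}$, $D_x:=\mathrm{Vert}(x)\setminus\{\text{terminal vertices}\}$. The map $\varphi$ characterized in the claim is a well-defined bijection. Zinno's map: Let $\mathbf{s}_1,\dots,\mathbf{s}_n$ be the standard generators of the braid group on $n+1$ strands. For $1\le i\le k\le n$ the syllable $\mathbf{s}_{i,k+1}$ is the word $\mathbf{s}_k^{-1}\mathbf{s}_{k-1}^{-1}\cdots\mathbf{s}_{i+1}^{-1}\,\mathbf{s}_i\,\mathbf{s}_{i+1}\cdots\mathbf{s}_k$; its letter $\mathbf{s}_i$ is its center. To a cycle $(i_1,\dots,i_k)$ with $i_1<\dots<i_k$ associate the word $\mathbf{s}_{i_1,i_2}\mathbf{s}_{i_2,i_3}\cdots\mathbf{s}_{i_{k-1},i_k}$.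 For $x\in\mathcal{P}_c$, the word $\mathbf{m}_x$ is the concatenation of the words of the cycles of $x$, ordered by increasing maximal element of the cycle. Extract a subword (subsequence of letters) $\mathbf{w}_x$ of $\mathbf{m}_x$ as follows: each syllable containing a letter $\mathbf{s}_i^{\pm1}$ contributes exactly one of its letters indexed by $i$; if $\mathbf{s}_i$ is the center of some syllable of $\mathbf{m}_x$, then every syllable containing letters indexed by $i$ contributes its letter $\mathbf{s}_i$ with positive exponent; if $\mathbf{s}_i$ is not the center of any syllable of $\mathbf{m}_x$, then every syllable containing letters indexed by $i$ contributes its letter $\mathbf{s}_i^{-1}$. Replacing each $\mathbf{s}_i^{\pm1}$ by $s_i$ in $\mathbf{w}_x$ gives a word in $\mathcal{S}$, and $w_x\in\mathcal{W}$ denotes the permutation it represents. Zinno showed that this word is a reduced expression of a fully commutative element and that $a:\mathcal{P}_c\to\mathcal{W}_f$, $x\mapsto w_x$ is a bijection. *)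

theory Defs
  imports "HOL-Combinatorics.Permutations"
begin

text \<open>The group \<open>W\<close> is the symmetric group on \<open>{1..n+1}\<close>, realised by the functions
  \<open>w :: nat \<Rightarrow> nat\<close> with \<open>w permutes {1..n+1}\<close>; the product is composition from right to left.\<close>

definition Sym :: "nat \<Rightarrow> (nat \<Rightarrow> nat) set" where
  "Sym n = {w. w permutes {1..n+1}}"

definition simple_refl :: "nat \<Rightarrow> nat \<Rightarrow> nat" where
  "simple_refl i = transpose i (i + 1)"

definition simple_refls :: "nat \<Rightarrow> (nat \<Rightarrow> nat) set" where
  "simple_refls n = simple_refl ` {1..n}"

definition transpositions :: "nat \<Rightarrow> (nat \<Rightarrow> nat) set" where
  "transpositions n = {transpose a b | a b. 1 \<le> a \<and> a < b \<and> b \<le> n + 1}"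

definition comp_list :: "('a \<Rightarrow> 'a) list \<Rightarrow> 'a \<Rightarrow> 'a" where
  "comp_list ps = foldr (\<circ>) ps id"

definition word_length :: "('a \<Rightarrow> 'a) set \<Rightarrow> ('a \<Rightarrow> 'a) \<Rightarrow> nat" where
  "word_length G w = (LEAST k. \<exists>ps. length ps = k \<and> set ps \<subseteq> G \<and> comp_list ps = w)"

text \<open>A word in the simple transpositions is given by its list of indices.\<close>

definition word_perm :: "nat list \<Rightarrow> nat \<Rightarrow> nat" where
  "word_perm is = comp_list (map simple_refl is)"

definition reduced_word :: "nat \<Rightarrow> (nat \<Rightarrow> nat) \<Rightarrow> nat list \<Rightarrow> bool" where
  "reduced_word n w is \<longleftrightarrow>
     set is \<subseteq> {1..n} \<and> word_perm is = w \<and> length is = word_length (simple_refls n) w"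

definition comm_move :: "nat list \<Rightarrow> nat list \<Rightarrow> bool" where
  "comm_move us vs \<longleftrightarrow>
     (\<exists>xs ys i j. us = xs @ [i, j] @ ys \<and> vs = xs @ [j, i] @ ys \<and>
        simple_refl i \<circ> simple_refl j = simple_refl j \<circ> simple_refl i)"

definition fully_commutative :: "nat \<Rightarrow> (nat \<Rightarrow> nat) set" where
  "fully_commutative n =
     {w \<in> Sym n. \<forall>us vs. reduced_word n w us \<longrightarrow> reduced_word n w vs \<longrightarrow> comm_move\<^sup>*\<^sup>* us vs}"

definition descending :: "nat \<Rightarrow> nat \<Rightarrow> nat list" where
  "descending i j = rev [j..<i + 1]"

definition normal_form :: "nat \<Rightarrow> (nat \<Rightarrow> nat) \<Rightarrow> nat list \<Rightarrow> nat list \<Rightarrow> bool" where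
  "normal_form n w is js \<longleftrightarrow>
     length is = length js \<and> set is \<subseteq> {1..n} \<and> set js \<subseteq> {1..n} \<and>
     sorted_wrt (<) is \<and> sorted_wrt (<) js \<and> (\<forall>m < length is. js ! m \<le> is ! m) \<and>
     reduced_word n w (concat (map2 descending is js))"

text \<open>The normal form exists and is unique for every fully commutative \<open>w\<close>; the sets
  below are only meant for such \<open>w\<close>.\<close>

definition the_normal_form :: "nat \<Rightarrow> (nat \<Rightarrow> nat) \<Rightarrow> nat list \<times> nat list" where
  "the_normal_form n w = (THE p. normal_form n w (fst p) (snd p))"

definition I_set :: "nat \<Rightarrow> (nat \<Rightarrow> nat) \<Rightarrow> nat set" where
  "I_set n w = set (fst (the_normal_form n w))"

definition J_set :: "nat \<Rightarrow> (nat \<Rightarrow> nat) \<Rightarrow> nat set" where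
  "J_set n w = set (snd (the_normal_form n w))"

definition cox :: "nat \<Rightarrow> nat \<Rightarrow> nat" where
  "cox n = word_perm [1..<n + 1]"

definition abs_le :: "nat \<Rightarrow> (nat \<Rightarrow> nat) \<Rightarrow> (nat \<Rightarrow> nat) \<Rightarrow> bool" where
  "abs_le n u v \<longleftrightarrow>
     word_length (transpositions n) u + word_length (transpositions n) (inv u \<circ> v)
       = word_length (transpositions n) v"

definition noncrossing :: "nat \<Rightarrow> (nat \<Rightarrow> nat) set" where
  "noncrossing n = {x \<in> Sym n. abs_le n x (cox n)}"

text \<open>A polygon \<open>[i\<^sub>1\<cdots>i\<^sub>k]\<close> of \<open>x\<close> is the strictly increasing list of the entries of a cycle
  \<open>(i\<^sub>1, \<dots>, i\<^sub>k)\<close> of \<open>x\<close> with \<open>k \<ge> 2\<close>. For \<open>x\<close> noncrossing every nontrivial cycle of \<open>x\<close> has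
  this shape. The initial and terminal vertices are the first and last entry of the list.\<close>

definition polygons :: "(nat \<Rightarrow> nat) \<Rightarrow> nat list set" where
  "polygons x = {is. 2 \<le> length is \<and> sorted_wrt (<) is \<and>
     (\<forall>j < length is. x (is ! j) = is ! (Suc j mod length is))}"

definition Vert :: "(nat \<Rightarrow> nat) \<Rightarrow> nat set" where
  "Vert x = (\<Union>is \<in> polygons x. set is)"

definition U_set :: "(nat \<Rightarrow> nat) \<Rightarrow> nat set" where
  "U_set x = Vert x - hd ` polygons x"

definition D_set :: "(nat \<Rightarrow> nat) \<Rightarrow> nat set" where
  "D_set x = Vert x - last ` polygons x"

definition shift :: "int set \<Rightarrow> int \<Rightarrow> int set" where
  "shift A m = (\<lambda>a. a + m) ` A"

text \<open>A fully commutative \<open>w\<close> is determined by its pair of sets, so that \<open>THE\<close> selects the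
  only element with the required sets when \<open>x\<close> is noncrossing.\<close>

definition phi :: "nat \<Rightarrow> (nat \<Rightarrow> nat) \<Rightarrow> nat \<Rightarrow> nat" where
  "phi n x = (THE w. w \<in> fully_commutative n \<and>
     J_set n w = D_set x \<and> int ` I_set n w = shift (int ` U_set x) (-1))"

text \<open>Only words in the standard generators of the braid group and their formal inverses
  are used, not the braids that they represent.\<close>

datatype braid_letter = Gen (letter_index: nat) | InvGen (letter_index: nat)

text \<open>A pair \<open>(i, m)\<close> with \<open>i < m\<close> stands for the syllable
  \<open>s\<^sub>m\<^sub>-\<^sub>1\<^sup>-\<^sup>1 \<cdots> s\<^sub>i\<^sub>+\<^sub>1\<^sup>-\<^sup>1 s\<^sub>i s\<^sub>i\<^sub>+\<^sub>1 \<cdots> s\<^sub>m\<^sub>-\<^sub>1\<close>, whose center is \<open>s\<^sub>i\<close>.\<close>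

fun syllable_word :: "nat \<times> nat \<Rightarrow> braid_letter list" where
  "syllable_word (i, m) = map InvGen (rev [i + 1..<m]) @ map Gen [i..<m]"

definition cycle_syllables :: "nat list \<Rightarrow> (nat \<times> nat) list" where
  "cycle_syllables is = zip is (tl is)"

definition syllables :: "(nat \<Rightarrow> nat) \<Rightarrow> (nat \<times> nat) list" where
  "syllables x = concat (map cycle_syllables (sorted_key_list_of_set last (polygons x)))"

definition m_word :: "(nat \<Rightarrow> nat) \<Rightarrow> braid_letter list" where
  "m_word x = concat (map syllable_word (syllables x))"

definition is_center :: "(nat \<Rightarrow> nat) \<Rightarrow> nat \<Rightarrow> bool" where
  "is_center x i \<longleftrightarrow> i \<in> fst ` set (syllables x)"

fun kept :: "(nat \<Rightarrow> nat) \<Rightarrow> braid_letter \<Rightarrow> bool" where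
  "kept x (Gen i) \<longleftrightarrow> is_center x i"
| "kept x (InvGen i) \<longleftrightarrow> \<not> is_center x i"

text \<open>Filtering keeps exactly one letter of index \<open>i\<close> from each syllable in which the
  index \<open>i\<close> occurs: a syllable contains one positive letter for each of its indices, and one
  negative letter for each of its indices except that of its center.\<close>

definition w_word :: "(nat \<Rightarrow> nat) \<Rightarrow> braid_letter list" where
  "w_word x = filter (kept x) (m_word x)"

definition zinno :: "(nat \<Rightarrow> nat) \<Rightarrow> nat \<Rightarrow> nat" where
  "zinno x = word_perm (map letter_index (w_word x))"

end

theory Submission
  imports Defs
begin

text \<open>
  Both maps are read off from where a permutation moves points upwards. In a word in the simple
  transpositions each letter raises exactly one point by one, so the total upward displacement of
  the permutation is at most the length of the word. Call a word tight if some finite set of points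
  exhausts this bound. A tight word is reduced, and no word in its commutation class contains a
  factor \<open>s s\<close> or \<open>s t s\<close> with adjacent \<open>s, t\<close>
  (\<open>ascent_braid_factor\<close>, \<open>braid_free_if_tight\<close>). Words with the latter property can be brought
  by commutations into the staircase normal form (\<open>braid_free_staircase\<close>). Staircase words are
  themselves tight: the block from \<open>i\<close> down to \<open>j\<close> carries \<open>j\<close> to \<open>i + 1\<close>. Hence for a fully
  commutative \<open>w\<close> the sets \<open>J\<close> and \<open>I\<close> consist of the points \<open>k < w k\<close> and of the numbers
  \<open>w k - 1\<close> for these points (\<open>corners_fully_commutative\<close>), they determine \<open>w\<close>, and conversely
  every tight word represents a fully commutative element (\<open>fully_commutative_if_tight\<close>).

  It remains to see that Zinno's word for a noncrossing \<open>x\<close> is tight, and that its permutation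
  carries \<open>D\<close>, the set of non-terminal vertices, onto \<open>U\<close>, the set of non-initial vertices, raising
  every point of \<open>D\<close>. The centers of the syllables are exactly the points of \<open>D\<close>, and the letters
  kept from the syllable of an arc \<open>(i, m)\<close> push every point of \<open>D\<close> under the arc up to the next one
  and the last of them to \<open>m\<close> (\<open>arc_block_action\<close>); as a set, \<open>i\<close> is replaced by \<open>m\<close>, at the price
  of \<open>m - i\<close> letters. The order of the syllables ensures that this description stays valid when the
  arcs act one after the other (\<open>arcs_word_action\<close>), so that altogether the left endpoints \<open>D\<close> are
  replaced by the right endpoints \<open>U\<close> and no letter is wasted.

  That order is only available because arcs of \<open>x\<close> do not cross (\<open>noncrossing_no_crossing\<close>). If
  \<open>(a, x a)\<close> and \<open>(b, x b)\<close> crossed, both transpositions could be split off from a shortest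
  factorisation of the Coxeter element \<open>c\<close>, although multiplying \<open>c\<close> by them yields another
  \<open>(n + 1)\<close>-cycle, which needs \<open>n\<close> transpositions.
\<close>

section \<open>Words in the simple transpositions\<close>

lemma comp_list_simps [simp]:
  "comp_list [] = id" "comp_list (p # ps) = p \<circ> comp_list ps"
  by (simp_all add: comp_list_def)

lemma comp_list_append [simp]: "comp_list (ps @ qs) = comp_list ps \<circ> comp_list qs"
  by (induction ps) auto

lemma word_perm_simps [simp]:
  "word_perm [] = id" "word_perm (i # us) = simple_refl i \<circ> word_perm us"
  by (simp_all add: word_perm_def)

lemma word_perm_append [simp]: "word_perm (us @ vs) = word_perm us \<circ> word_perm vs"
  by (simp add: word_perm_def)

lemma simple_refl_apply: "simple_refl i v = (if v = i then Suc i else if v = Suc i then i else v)"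
  by (simp add: simple_refl_def transpose_def)

lemma word_perm_square: "word_perm (xs @ [k, k] @ ys) = word_perm (xs @ ys)"
  by (auto simp: fun_eq_iff simple_refl_apply)

lemma bij_word_perm: "bij (word_perm us)"
  by (induction us) (auto simp: simple_refl_def intro: bij_comp simp del: comp_apply id_apply)

lemma word_perm_fixes:
  assumes "\<And>k. k \<in> set us \<Longrightarrow> v \<noteq> k \<and> v \<noteq> Suc k"
  shows "word_perm us v = v"
  using assms by (induction us) (auto simp: simple_refl_apply)

lemma word_perm_Sym:
  assumes "set us \<subseteq> {1..n}"
  shows "word_perm us \<in> Sym n"
  using assms
proof (induction us)
  case Nil
  then show ?case by (simp add: Sym_def permutes_id del: id_apply)
next
  case (Cons k us)
  have "simple_refl k permutes {1..n + 1}"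
    unfolding simple_refl_def using Cons.prems by (intro permutes_swap_id) auto
  with Cons show ?case by (auto simp: Sym_def simp del: comp_apply intro: permutes_compose)
qed

lemma simple_refl_commute:
  assumes "Suc i < j \<or> Suc j < i"
  shows "simple_refl i \<circ> simple_refl j = simple_refl j \<circ> simple_refl i"
  using assms by (intro ext) (auto simp: simple_refl_apply)

lemma simple_refl_braid:
  "simple_refl k \<circ> simple_refl (Suc k) \<circ> simple_refl k = transpose k (k + 2)"
  "simple_refl (Suc k) \<circ> simple_refl k \<circ> simple_refl (Suc k) = transpose k (k + 2)"
  by (auto simp: fun_eq_iff simple_refl_apply transpose_def)

lemma transpose_eq_word_perm:
  assumes "1 \<le> a" "a < b" "b \<le> n + 1"
  shows "\<exists>us. set us \<subseteq> {1..n} \<and> word_perm us = transpose a b"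
  using assms(2,3)
proof (induction b)
  case (Suc b)
  show ?case
  proof (cases "a = b")
    case True
    then have "set [b] \<subseteq> {1..n}" "word_perm [b] = transpose a (Suc b)"
      using Suc.prems assms(1) by (auto simp: simple_refl_def)
    then show ?thesis by blast
  next
    case False
    then obtain us where us: "set us \<subseteq> {1..n}" "word_perm us = transpose a b"
      using Suc by auto
    have "word_perm ([b] @ us @ [b]) = transpose a (Suc b)"
      using False Suc.prems us(2) by (auto simp: fun_eq_iff simple_refl_apply transpose_def)
    moreover have "set ([b] @ us @ [b]) \<subseteq> {1..n}"
      using us(1) Suc.prems assms(1) by auto
    ultimately show ?thesis by blast
  qed
qed simp

lemma Sym_eq_word_perm:
  assumes "w \<in> Sym n"
  shows "\<exists>us. set us \<subseteq> {1..n} \<and> word_perm us = w"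
proof -
  have "w permutes {1..n + 1}" "finite {1..n + 1}"
    using assms by (simp_all add: Sym_def)
  then show ?thesis
  proof (induction rule: permutes_induct)
    case id
    have "set [] \<subseteq> {1..n} \<and> word_perm [] = id"
      by simp
    then show ?case by blast
  next
    case (swap a b p)
    have "\<exists>vs. set vs \<subseteq> {1..n} \<and> word_perm vs = transpose a b"
      using swap.hyps transpose_eq_word_perm[of a b n] transpose_eq_word_perm[of b a n]
      by (cases "a < b") (auto simp: transpose_commute)
    then obtain us vs where "set us \<subseteq> {1..n}" "word_perm us = p"
      "set vs \<subseteq> {1..n}" "word_perm vs = transpose a b"
      using swap.IH by blast
    then have "set (vs @ us) \<subseteq> {1..n} \<and> word_perm (vs @ us) = transpose a b \<circ> p"
      by simp
    then show ?case by blast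
  qed
qed

lemma word_length_le:
  assumes "set ps \<subseteq> G" "comp_list ps = w"
  shows "word_length G w \<le> length ps"
  unfolding word_length_def using assms by (intro Least_le) blast

lemma word_length_attained:
  assumes "set ps \<subseteq> G" "comp_list ps = w"
  shows "\<exists>qs. length qs = word_length G w \<and> set qs \<subseteq> G \<and> comp_list qs = w"
  unfolding word_length_def
  by (rule LeastI[where P = "\<lambda>k. \<exists>qs. length qs = k \<and> set qs \<subseteq> G \<and> comp_list qs = w"])
    (use assms in blast)

lemma reduced_word_exists:
  assumes "w \<in> Sym n"
  shows "\<exists>us. reduced_word n w us"
proof -
  obtain us where "set us \<subseteq> {1..n}" "word_perm us = w"
    using Sym_eq_word_perm[OF assms] by blast
  then obtain qs where qs: "length qs = word_length (simple_refls n) w"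
    "set qs \<subseteq> simple_refls n" "comp_list qs = w"
    using word_length_attained[of "map simple_refl us" "simple_refls n" w]
    by (auto simp: simple_refls_def word_perm_def)
  from qs(2) have "qs \<in> map simple_refl ` lists {1..n}"
    unfolding simple_refls_def lists_image[symmetric] by auto
  then obtain vs where "qs = map simple_refl vs" "set vs \<subseteq> {1..n}"
    by auto
  with qs show ?thesis by (auto simp: reduced_word_def word_perm_def)
qed

lemma reduced_word_le:
  assumes "reduced_word n w us" "set vs \<subseteq> {1..n}" "word_perm vs = w"
  shows "length us \<le> length vs"
  using assms word_length_le[of "map simple_refl vs" "simple_refls n" w]
  by (auto simp: reduced_word_def simple_refls_def word_perm_def)

section \<open>Upward displacement\<close>

text \<open>Truncated subtraction makes this the total distance by which \<open>w\<close> raises the points of \<open>S\<close>,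
  points that are lowered not being counted.\<close>

definition ascent :: "nat set \<Rightarrow> (nat \<Rightarrow> nat) \<Rightarrow> nat" where
  "ascent S w = (\<Sum>k\<in>S. w k - k)"

text \<open>Only the point that \<open>w\<close> sends to \<open>a\<close> is raised by the transposition, and by \<open>b - a\<close>.\<close>

lemma ascent_transpose:
  assumes "finite S" "inj w" "a \<le> b"
  shows "ascent S (transpose a b \<circ> w) \<le> ascent S w + (b - a)"
proof -
  have "ascent S (transpose a b \<circ> w) \<le> (\<Sum>k\<in>S. (w k - k) + (if w k = a then b - a else 0))"
    unfolding ascent_def using assms(3) by (intro sum_mono) (auto simp: transpose_def)
  also have "\<dots> = ascent S w + (\<Sum>k\<in>S. if w k = a then b - a else 0)"
    by (simp only: ascent_def sum.distrib)
  also have "(\<Sum>k\<in>S. if w k = a then b - a else 0) = (\<Sum>k\<in>{k\<in>S. w k = a}. b - a)"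
    by (rule sum.inter_filter[OF assms(1), symmetric])
  also have "(\<Sum>k\<in>{k\<in>S. w k = a}. b - a) \<le> b - a"
  proof -
    have "card {k\<in>S. w k = a} \<le> card {a}"
      using assms(2) by (intro card_inj_on_le[where f = w]) (auto simp: inj_on_def)
    then show ?thesis by simp
  qed
  finally show ?thesis by (simp del: comp_apply)
qed

lemma ascent_word_le_append:
  assumes "finite S"
  shows "ascent S (word_perm (us @ vs)) \<le> length us + ascent S (word_perm vs)"
proof (induction us)
  case (Cons k us)
  have "ascent S (simple_refl k \<circ> word_perm (us @ vs)) \<le> ascent S (word_perm (us @ vs)) + 1"
    using ascent_transpose[OF assms bij_is_inj[OF bij_word_perm], of k "Suc k" "us @ vs"]
    by (simp add: simple_refl_def)
  with Cons show ?case by (simp del: comp_apply)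
qed simp

lemma ascent_word_le:
  assumes "finite S"
  shows "ascent S (word_perm us) \<le> length us"
  using ascent_word_le_append[OF assms, of us "[]"] by (simp add: ascent_def)

text \<open>Three letters \<open>s t s\<close> with adjacent \<open>s, t\<close> multiply to a transposition at distance \<open>2\<close>, so
  they raise the displacement by at most \<open>2\<close>: a word whose length equals the displacement cannot
  contain them.\<close>

lemma ascent_braid_factor:
  assumes "finite S" "us \<in> {[k, Suc k, k], [Suc k, k, Suc k]}"
  shows "ascent S (word_perm (xs @ us @ ys)) < length (xs @ us @ ys)"
proof -
  have us: "word_perm us = transpose k (k + 2)" "length us = 3"
    using assms(2) simple_refl_braid[of k] by (auto simp: comp_assoc)
  have "ascent S (word_perm (xs @ us @ ys)) \<le> length xs + ascent S (word_perm (us @ ys))"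
    by (rule ascent_word_le_append[OF assms(1)])
  also have "ascent S (word_perm (us @ ys)) \<le> ascent S (word_perm ys) + 2"
    using ascent_transpose[OF assms(1) bij_is_inj[OF bij_word_perm], of k "k + 2" ys] us by simp
  also have "ascent S (word_perm ys) \<le> length ys"
    by (rule ascent_word_le[OF assms(1)])
  finally show ?thesis using us(2) by simp
qed

text \<open>If the displacement over \<open>S\<close> exhausts the length of a word, nothing is left for points
  outside \<open>S\<close>.\<close>

lemma excedances_if_tight:
  assumes "finite S" "ascent S (word_perm us) = length us" "\<And>k. k \<in> S \<Longrightarrow> k < word_perm us k"
  shows "{k. k < word_perm us k} = S"
proof (rule ccontr)
  assume "\<not> ?thesis"
  then obtain k where k: "k < word_perm us k" "k \<notin> S"
    using assms(3) by blast
  then have "ascent (insert k S) (word_perm us) > length us"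
    using assms(1,2) by (simp add: ascent_def)
  moreover have "ascent (insert k S) (word_perm us) \<le> length us"
    using assms(1) by (intro ascent_word_le) simp
  ultimately show False by simp
qed

section \<open>Commutation classes of words\<close>

abbreviation comm_equiv :: "nat list \<Rightarrow> nat list \<Rightarrow> bool" (infix "\<approx>" 50) where
  "us \<approx> vs \<equiv> comm_move\<^sup>*\<^sup>* us vs"

lemma comm_equiv_sym: "us \<approx> vs \<Longrightarrow> vs \<approx> us"
proof (rule sympD[OF symp_rtranclp])
  show "symp comm_move"
    unfolding symp_def comm_move_def by metis
qed

lemma comm_equiv_context:
  assumes "us \<approx> vs"
  shows "xs @ us @ ys \<approx> xs @ vs @ ys"
  using assms
proof (induction rule: rtranclp_induct)
  case (step vs zs)
  have "comm_move (xs @ vs @ ys) (xs @ zs @ ys)"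
  proof -
    from step.hyps(2) obtain as bs i j where *: "vs = as @ [i, j] @ bs" "zs = as @ [j, i] @ bs"
      "simple_refl i \<circ> simple_refl j = simple_refl j \<circ> simple_refl i"
      unfolding comm_move_def by blast
    then have "xs @ vs @ ys = (xs @ as) @ [i, j] @ (bs @ ys)"
      "xs @ zs @ ys = (xs @ as) @ [j, i] @ (bs @ ys)"
      by simp_all
    with *(3) show ?thesis unfolding comm_move_def by blast
  qed
  with step.IH show ?case by (rule rtranclp.rtrancl_into_rtrancl)
qed simp

lemma comm_equiv_invariants:
  assumes "us \<approx> vs"
  shows "word_perm vs = word_perm us" "mset vs = mset us"
proof -
  have "word_perm vs = word_perm us \<and> mset vs = mset us"
    using assms
  proof (induction rule: rtranclp_induct)
    case (step vs zs)
    then obtain as bs i j where *: "vs = as @ [i, j] @ bs" "zs = as @ [j, i] @ bs"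
      "simple_refl i \<circ> simple_refl j = simple_refl j \<circ> simple_refl i"
      unfolding comm_move_def by blast
    have "word_perm zs = word_perm as \<circ> (simple_refl j \<circ> simple_refl i) \<circ> word_perm bs"
      by (simp add: *(2) comp_assoc)
    also have "\<dots> = word_perm vs"
      by (simp add: *(1) comp_assoc flip: *(3))
    finally have "word_perm zs = word_perm vs" .
    moreover have "mset zs = mset vs"
      by (simp add: *)
    ultimately show ?case using step.IH by metis
  qed simp
  then show "word_perm vs = word_perm us" "mset vs = mset us" by auto
qed

lemma comm_equiv_set: "us \<approx> vs \<Longrightarrow> set vs = set us"
  and comm_equiv_length: "us \<approx> vs \<Longrightarrow> length vs = length us"
  by (auto dest: comm_equiv_invariants(2) mset_eq_setD mset_eq_length)

lemma comm_equiv_reduced: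
  assumes "us \<approx> vs" "reduced_word n w us"
  shows "reduced_word n w vs"
  using assms comm_equiv_invariants(1)[OF assms(1)] comm_equiv_set[OF assms(1)]
    comm_equiv_length[OF assms(1)]
  by (simp add: reduced_word_def)

lemma letter_past_word:
  assumes "\<And>l. l \<in> set us \<Longrightarrow> Suc k < l \<or> Suc l < k"
  shows "k # us \<approx> us @ [k]"
  using assms
proof (induction us)
  case (Cons l us)
  have "comm_move (k # l # us) (l # k # us)"
    unfolding comm_move_def
    by (intro exI[of _ "[]"] exI[of _ us] exI[of _ k] exI[of _ l])
      (use simple_refl_commute[of k l] Cons.prems in auto)
  moreover have "l # k # us \<approx> l # us @ [k]"
    using comm_equiv_context[of "k # us" "us @ [k]" "[l]" "[]"] Cons by simp
  ultimately show ?case by (simp add: converse_rtranclp_into_rtranclp)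
qed simp

definition has_short_factor :: "nat list \<Rightarrow> bool" where
  "has_short_factor us \<longleftrightarrow>
     (\<exists>xs k f ys. us = xs @ f @ ys \<and> f \<in> {[k, k], [k, Suc k, k], [Suc k, k, Suc k]})"

definition braid_free :: "nat list \<Rightarrow> bool" where
  "braid_free us \<longleftrightarrow> (\<forall>vs. us \<approx> vs \<longrightarrow> \<not> has_short_factor vs)"

lemma has_short_factorI:
  "has_short_factor (xs @ [k, k] @ ys)"
  "has_short_factor (xs @ [k, Suc k, k] @ ys)"
  "has_short_factor (xs @ [Suc k, k, Suc k] @ ys)"
  unfolding has_short_factor_def by blast+

lemma braid_free_equiv: "braid_free us \<Longrightarrow> us \<approx> vs \<Longrightarrow> braid_free vs"
  unfolding braid_free_def by (meson rtranclp_trans)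

lemma braid_freeD: "braid_free us \<Longrightarrow> us \<approx> vs \<Longrightarrow> has_short_factor vs \<Longrightarrow> False"
  unfolding braid_free_def by blast

lemma braid_free_prefix:
  assumes "braid_free (us @ ys)"
  shows "braid_free us"
  unfolding braid_free_def
proof (intro allI impI notI)
  fix vs assume "us \<approx> vs" "has_short_factor vs"
  from comm_equiv_context[OF this(1), of "[]" ys] have move: "us @ ys \<approx> vs @ ys" by simp
  have "has_short_factor (vs @ ys)"
    using \<open>has_short_factor vs\<close> unfolding has_short_factor_def by (metis append_assoc)
  then show False by (rule braid_freeD[OF assms move])
qed

text \<open>In a tight word every letter raises the displacement by one, which \<open>s s\<close> and \<open>s t s\<close> do not
  allow; and tightness only depends on the length and on the permutation.\<close>

lemma braid_free_if_tight:
  assumes "finite S" "ascent S (word_perm us) = length us"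
  shows "braid_free us"
  unfolding braid_free_def
proof (intro allI impI notI)
  fix vs assume "us \<approx> vs" "has_short_factor vs"
  then have tight: "ascent S (word_perm vs) = length vs"
    using assms comm_equiv_invariants comm_equiv_length by metis
  obtain xs k f ys where vs: "vs = xs @ f @ ys"
    and f: "f = [k, k] \<or> f \<in> {[k, Suc k, k], [Suc k, k, Suc k]}"
    using \<open>has_short_factor vs\<close> unfolding has_short_factor_def by auto
  show False
  proof (cases "f = [k, k]")
    case True
    then have "word_perm vs = word_perm (xs @ ys)"
      unfolding vs by (simp only: word_perm_square)
    with tight have "ascent S (word_perm (xs @ ys)) = length vs" by metis
    then show False
      using ascent_word_le[OF assms(1), of "xs @ ys"] by (simp add: vs True)
  next
    case False
    then show False
      using f ascent_braid_factor[OF assms(1)] tight vs by (metis less_irrefl)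
  qed
qed

text \<open>A factor \<open>s s\<close> contradicts reducedness, and a braid move changes the multiset of letters, so it
  leads to a reduced word outside the commutation class.\<close>

lemma braid_free_if_fully_commutative:
  assumes "w \<in> fully_commutative n" "reduced_word n w us"
  shows "braid_free us"
  unfolding braid_free_def
proof (intro allI impI notI)
  fix vs assume "us \<approx> vs" "has_short_factor vs"
  then have red: "reduced_word n w vs"
    using assms(2) comm_equiv_reduced by blast
  obtain xs k f ys where vs: "vs = xs @ f @ ys"
    and f: "f \<in> {[k, k], [k, Suc k, k], [Suc k, k, Suc k]}"
    using \<open>has_short_factor vs\<close> unfolding has_short_factor_def by auto
  have other: "reduced_word n w (xs @ g @ ys)"
    if "word_perm g = word_perm f" "set g = set f" "length g = length f" for g
    using red that by (simp add: reduced_word_def vs)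
  have no_move: "mset g = mset f"
    if "word_perm g = word_perm f" "set g = set f" "length g = length f" for g
  proof -
    have "vs \<approx> xs @ g @ ys"
      using assms(1) red other[OF that] by (auto simp: fully_commutative_def)
    from comm_equiv_invariants(2)[OF this] show ?thesis by (simp add: vs)
  qed
  consider "f = [k, k]" | "f = [k, Suc k, k]" | "f = [Suc k, k, Suc k]"
    using f by auto
  then show False
  proof cases
    case 1
    then have "word_perm (xs @ ys) = word_perm vs"
      unfolding vs by (simp only: word_perm_square)
    moreover have "word_perm vs = w" "set (xs @ ys) \<subseteq> {1..n}"
      using red by (auto simp: reduced_word_def vs)
    ultimately have "length vs \<le> length (xs @ ys)"
      by (intro reduced_word_le[OF red]) simp_all
    then show False by (simp add: vs 1)
  next
    case 2
    then show False
      using no_move[of "[Suc k, k, Suc k]"] simple_refl_braid[of k] by (auto simp: comp_assoc)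
  next
    case 3
    then show False
      using no_move[of "[k, Suc k, k]"] simple_refl_braid[of k] by (auto simp: comp_assoc)
  qed
qed

section \<open>Staircase normal forms\<close>

definition stair_word :: "(nat \<times> nat) list \<Rightarrow> nat list" where
  "stair_word bs = concat (map (\<lambda>(i, j). descending i j) bs)"

definition staircase :: "(nat \<times> nat) list \<Rightarrow> bool" where
  "staircase bs \<longleftrightarrow>
     sorted_wrt (\<lambda>(i, j) (i', j'). i < i' \<and> j < j') bs \<and> (\<forall>(i, j) \<in> set bs. j \<le> i)"

lemma stair_word_simps [simp]:
  "stair_word [] = []"
  "stair_word (b # bs) = descending (fst b) (snd b) @ stair_word bs"
  "stair_word (as @ bs) = stair_word as @ stair_word bs"
  by (auto simp: stair_word_def split: prod.splits)

lemma set_descending [simp]: "set (descending i j) = {j..i}"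
  by (auto simp: descending_def)

lemma length_descending [simp]: "length (descending i j) = Suc i - j"
  by (cases "j \<le> i") (simp_all add: descending_def Suc_diff_le)

lemma set_stair_word: "set (stair_word bs) = (\<Union>(i, j) \<in> set bs. {j..i})"
  by (auto simp: stair_word_def)

lemma descending_split:
  assumes "j \<le> k" "k < i"
  shows "descending i j = descending i (Suc k) @ descending k j"
  using assms upt_add_eq_append[of j "Suc k" "i - k"]
  by (simp add: descending_def flip: rev_append)

lemma descending_self [simp]: "descending k k = [k]"
  by (simp add: descending_def)

lemma descending_snoc:
  assumes "Suc j \<le> i"
  shows "descending i j = descending i (Suc j) @ [j]"
  using descending_split[of j j i] assms by simp

lemma word_perm_descending:
  assumes "j \<le> i"
  shows "word_perm (descending i j) j = Suc i"
  using assms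
proof (induction i rule: dec_induct)
  case (step i)
  have "descending (Suc i) j = Suc i # descending i j"
    using step.hyps by (simp add: descending_def)
  with step.IH show ?case by (simp add: simple_refl_apply)
qed (simp add: simple_refl_apply)

lemma word_perm_staircase:
  assumes "staircase bs" "(i, j) \<in> set bs"
  shows "word_perm (stair_word bs) j = Suc i"
proof -
  obtain as cs where bs: "bs = as @ (i, j) # cs"
    using assms(2) by (auto dest: split_list)
  have less: "k < i \<and> l < j \<and> l \<le> k" if "(k, l) \<in> set as" for k l
    using assms(1) that by (fastforce simp: staircase_def bs sorted_wrt_append)
  have greater: "i < k \<and> j < l" if "(k, l) \<in> set cs" for k l
    using assms(1) that by (fastforce simp: staircase_def bs sorted_wrt_append)
  have "j \<le> i" using assms by (auto simp: staircase_def)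
  have "word_perm (stair_word cs) j = j"
    using greater by (intro word_perm_fixes) (fastforce simp: set_stair_word)
  moreover have "word_perm (stair_word as) (Suc i) = Suc i"
    using less by (intro word_perm_fixes) (fastforce simp: set_stair_word)
  ultimately show ?thesis
    using word_perm_descending[OF \<open>j \<le> i\<close>] by (simp add: bs)
qed

lemma staircase_distinct:
  assumes "staircase bs"
  shows "distinct (map snd bs)" "sorted (map snd bs)" "distinct (map fst bs)" "sorted (map fst bs)"
proof -
  have "sorted_wrt (<) (map snd bs)" "sorted_wrt (<) (map fst bs)"
    using assms unfolding staircase_def sorted_wrt_map
    by (auto elim!: sorted_wrt_mono_rel[rotated])
  then show "distinct (map snd bs)" "sorted (map snd bs)"
    "distinct (map fst bs)" "sorted (map fst bs)"
    by (auto simp: strict_sorted_iff)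
qed

lemma staircase_tight:
  assumes "staircase bs"
  shows "ascent (snd ` set bs) (word_perm (stair_word bs)) = length (stair_word bs)"
proof -
  let ?w = "word_perm (stair_word bs)"
  have "ascent (snd ` set bs) ?w = sum_list (map (\<lambda>j. ?w j - j) (map snd bs))"
    using sum_list_distinct_conv_sum_set[OF staircase_distinct(1)[OF assms], of "\<lambda>j. ?w j - j"]
    by (simp add: ascent_def)
  also have "map (\<lambda>j. ?w j - j) (map snd bs) = map (\<lambda>(i, j). Suc i - j) bs"
    using word_perm_staircase[OF assms] by auto
  also have "sum_list (map (\<lambda>(i, j). Suc i - j) bs) = length (stair_word bs)"
    by (induction bs) auto
  finally show ?thesis .
qed

text \<open>Tightness makes the corners readable off the permutation, so a fully commutative element
  has only one staircase word.\<close>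

lemma staircase_corners:
  assumes "staircase bs" "word_perm (stair_word bs) = w"
  shows "snd ` set bs = {k. k < w k}" "fst ` set bs = {w k - 1 | k. k < w k}"
proof -
  have "k < word_perm (stair_word bs) k" if "k \<in> snd ` set bs" for k
    using that assms(1) word_perm_staircase[OF assms(1)] by (fastforce simp: staircase_def)
  from excedances_if_tight[OF _ staircase_tight[OF assms(1)] this]
  show J: "snd ` set bs = {k. k < w k}" by (simp add: assms(2))
  show "fst ` set bs = {w k - 1 | k. k < w k}" (is "_ = ?I")
  proof -
    have "?I = (\<lambda>k. w k - 1) ` (snd ` set bs)" unfolding J by auto
    also have "\<dots> = fst ` set bs"
      unfolding image_image using word_perm_staircase[OF assms(1)] assms(2)
      by (intro image_cong) auto
    finally show ?thesis by simp
  qed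
qed

lemma staircase_eq_if_corners_eq:
  assumes "staircase bs" "staircase cs"
    "fst ` set bs = fst ` set cs" "snd ` set bs = snd ` set cs"
  shows "bs = cs"
proof -
  have "map fst bs = map fst cs" "map snd bs = map snd cs"
    using assms staircase_distinct[of bs] staircase_distinct[of cs]
    by (auto intro!: sorted_distinct_set_unique)
  then show ?thesis by (metis zip_map_fst_snd)
qed

lemma staircase_unique:
  assumes "staircase bs" "staircase cs" "word_perm (stair_word bs) = word_perm (stair_word cs)"
  shows "bs = cs"
  using staircase_corners[OF assms(1,3)] staircase_corners[OF assms(2) refl]
  by (intro staircase_eq_if_corners_eq assms) simp_all

lemma staircase_snoc:
  "staircase (bs @ [(i, j)]) \<longleftrightarrow> staircase bs \<and> j \<le> i \<and> (\<forall>(k, l) \<in> set bs. k < i \<and> l < j)"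
  by (auto simp: staircase_def sorted_wrt_append)

text \<open>The new letter meets the last block. It either extends that block, or starts a new one, or
  commutes with the whole block and moves on to the left; in every other position it completes,
  after commutations, a factor \<open>s s\<close> or \<open>s t s\<close>.\<close>

lemma staircase_append_letter:
  assumes "staircase bs" "braid_free (stair_word bs @ [k])"
  shows "\<exists>cs. staircase cs \<and> stair_word bs @ [k] \<approx> stair_word cs \<and>
    fst ` set cs \<subseteq> insert k (fst ` set bs) \<and> snd ` set cs \<subseteq> insert k (snd ` set bs)"
  using assms
proof (induction bs rule: rev_induct)
  case Nil
  have "staircase [(k, k)]" by (simp add: staircase_def)
  then show ?case by (intro exI[of _ "[(k, k)]"]) auto
next
  case (snoc b bs)
  obtain i j where b: "b = (i, j)" by fastforce
  have st: "staircase bs" "j \<le> i" and less: "\<And>k l. (k, l) \<in> set bs \<Longrightarrow> k < i \<and> l < j"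
    using snoc.prems(1) by (auto simp: b staircase_snoc)
  have word: "stair_word (bs @ [b]) @ [k] = stair_word bs @ descending i j @ [k]"
    by (simp add: b)
  note bf = snoc.prems(2)[unfolded word]
  consider "k > i" | "k = j" | "Suc k = j" | "j < k" "k \<le> i" | "Suc k < j"
    by linarith
  then show ?case
  proof cases
    case 1
    have "staircase (bs @ [b, (k, k)])"
      using staircase_snoc[of "bs @ [b]" k k] snoc.prems(1) less 1 st(2) by (fastforce simp: b)
    then show ?thesis by (intro exI[of _ "bs @ [b, (k, k)]"]) (auto simp: b)
  next
    case 2
    have "descending i j @ [k] = (if j = i then [] else descending i (Suc j)) @ [k, k] @ []"
      using 2 st(2) descending_snoc[of j i] by auto
    then have "has_short_factor (stair_word bs @ descending i j @ [k])"
      using has_short_factorI(1) by (metis append_assoc)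
    then show ?thesis using braid_freeD[OF bf] by blast
  next
    case 3
    have desc: "descending i j @ [k] = descending i k"
      using 3 st(2) descending_snoc[of k i] by simp
    have "l < k" if mem: "(h, l) \<in> set bs" for h l
    proof (rule ccontr)
      assume "\<not> l < k"
      with less[OF mem] 3 have "l = k" by simp
      obtain as cs where bs: "bs = as @ (h, l) # cs"
        using mem by (auto dest: split_list)
      have "cs = []"
      proof (cases cs)
        case (Cons c cs')
        then have "l < snd c" using st(1) by (auto simp: staircase_def bs sorted_wrt_append)
        moreover have "snd c < j" using less[of "fst c" "snd c"] by (simp add: bs Cons)
        ultimately show ?thesis using \<open>l = k\<close> 3 by simp
      qed
      have "k \<le> h" using st(1) \<open>l = k\<close> by (auto simp: staircase_def bs)
      obtain ds where ds: "descending h k = ds @ [k]"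
        using \<open>k \<le> h\<close> descending_snoc[of k h] descending_self[of k] by (cases "k = h") auto
      obtain es where es: "descending i j = es @ [Suc k]" "\<And>e. e \<in> set es \<Longrightarrow> Suc k < e"
      proof (cases "i = j")
        case True
        with that[of "[]"] 3 show ?thesis by auto
      next
        case False
        with that[of "descending i (Suc j)"] st(2) 3 descending_snoc[of j i] show ?thesis by auto
      qed
      have "stair_word bs @ descending i j @ [k] = (stair_word as @ ds) @ (k # es) @ [Suc k, k]"
        by (simp add: bs \<open>cs = []\<close> \<open>l = k\<close> ds es)
      moreover have "k # es \<approx> es @ [k]"
        using es(2) by (intro letter_past_word) auto
      ultimately have "stair_word bs @ descending i j @ [k]
          \<approx> (stair_word as @ ds) @ (es @ [k]) @ [Suc k, k]"
        using comm_equiv_context by metis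
      moreover have "has_short_factor ((stair_word as @ ds) @ (es @ [k]) @ [Suc k, k])"
        using has_short_factorI(2)[of "stair_word as @ ds @ es" k "[]"] by simp
      ultimately show False using braid_freeD[OF bf] by blast
    qed
    then have "staircase (bs @ [(i, k)])"
      using st less 3 by (auto simp: staircase_snoc)
    then show ?thesis
      by (intro exI[of _ "bs @ [(i, k)]"]) (auto simp: b desc)
  next
    case 4
    then obtain k' where k: "k = Suc k'" "j \<le> k'" by (cases k) auto
    obtain ds where ds: "descending i k = ds @ [k]"
      using \<open>k \<le> i\<close> descending_snoc[of k i] descending_self[of k] by (cases "k = i") auto
    obtain es where es: "descending k' j = k' # es" "\<And>e. e \<in> set es \<Longrightarrow> e < k'"
      using k(2) that[of "rev [j..<k']"] by (simp add: descending_def)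
    have "stair_word bs @ descending i j @ [k] = (stair_word bs @ ds @ [k, k']) @ (es @ [k]) @ []"
      using descending_split[of j k' i] 4 k ds es(1) by simp
    moreover have "es @ [k] \<approx> k # es"
      using es(2) k by (intro comm_equiv_sym[OF letter_past_word]) auto
    ultimately have "stair_word bs @ descending i j @ [k]
        \<approx> (stair_word bs @ ds @ [k, k']) @ (k # es) @ []"
      using comm_equiv_context by metis
    moreover have "has_short_factor ((stair_word bs @ ds @ [k, k']) @ (k # es) @ [])"
      using has_short_factorI(3)[of "stair_word bs @ ds" k' es] k by simp
    ultimately show ?thesis using braid_freeD[OF bf] by blast
  next
    case 5
    have "descending i j @ [k] \<approx> k # descending i j"
      using 5 by (intro comm_equiv_sym[OF letter_past_word]) auto
    from comm_equiv_context[OF this, of "stair_word bs" "[]"]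
    have move: "stair_word bs @ descending i j @ [k] \<approx> (stair_word bs @ [k]) @ descending i j"
      by simp
    from braid_free_prefix[OF braid_free_equiv[OF bf this]] snoc.IH[OF st(1)]
    obtain cs where cs: "staircase cs" "stair_word bs @ [k] \<approx> stair_word cs"
      "fst ` set cs \<subseteq> insert k (fst ` set bs)" "snd ` set cs \<subseteq> insert k (snd ` set bs)"
      by blast
    have "g < i \<and> l < j" if "(g, l) \<in> set cs" for g l
    proof -
      have "g \<in> insert k (fst ` set bs)" "l \<in> insert k (snd ` set bs)"
        using that cs(3,4) by force+
      then show ?thesis using less 5 st(2) by fastforce
    qed
    then have "staircase (cs @ [b])"
      using cs(1) st(2) by (auto simp: b staircase_snoc)
    moreover have "stair_word (bs @ [b]) @ [k] \<approx> stair_word (cs @ [b])"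
      using rtranclp_trans[OF move] comm_equiv_context[OF cs(2), of "[]" "descending i j"]
      by (simp add: b)
    ultimately show ?thesis
      using cs(3,4) by (intro exI[of _ "cs @ [b]"]) auto
  qed
qed

lemma braid_free_staircase:
  assumes "braid_free us"
  shows "\<exists>bs. staircase bs \<and> us \<approx> stair_word bs"
  using assms
proof (induction us rule: rev_induct)
  case Nil
  have "staircase []" by (simp add: staircase_def)
  then show ?case by (intro exI[of _ "[]"]) simp
next
  case (snoc k us)
  obtain bs where bs: "staircase bs" "us \<approx> stair_word bs"
    using snoc.IH[OF braid_free_prefix[OF snoc.prems]] by blast
  from comm_equiv_context[OF bs(2), of "[]" "[k]"]
  have move: "us @ [k] \<approx> stair_word bs @ [k]" by simp
  from staircase_append_letter[OF bs(1) braid_free_equiv[OF snoc.prems move]]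
  show ?case using rtranclp_trans[OF move] by blast
qed

lemma normal_form_iff_staircase:
  "normal_form n w is js \<longleftrightarrow>
     length is = length js \<and> staircase (zip is js) \<and> reduced_word n w (stair_word (zip is js))"
  (is "?L \<longleftrightarrow> ?R")
proof
  assume ?L
  then show ?R
    by (auto simp: normal_form_def staircase_def sorted_wrt_iff_nth_less set_zip stair_word_def)
next
  assume R: ?R
  then have len: "length is = length js" and st: "staircase (zip is js)" by auto
  have le: "j \<le> i" if "(i, j) \<in> set (zip is js)" for i j
    using st that by (auto simp: staircase_def)
  have range: "{j..i} \<subseteq> {1..n}" if "(i, j) \<in> set (zip is js)" for i j
    using R that by (fastforce simp: reduced_word_def set_stair_word)
  have nth: "(is ! m, js ! m) \<in> set (zip is js)" if "m < length is" for m
    using that len by (auto simp: set_zip)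
  have "1 \<le> js ! m \<and> js ! m \<le> is ! m \<and> is ! m \<le> n" if "m < length is" for m
    using le[OF nth[OF that]] range[OF nth[OF that]] by auto
  then have "set is \<subseteq> {1..n}" "set js \<subseteq> {1..n}" "\<forall>m < length is. js ! m \<le> is ! m"
    using len by (force simp: in_set_conv_nth)+
  then show ?L
    using R by (auto simp: normal_form_def staircase_def sorted_wrt_iff_nth_less stair_word_def)
qed

lemma the_normal_form_eq:
  assumes "staircase bs" "reduced_word n w (stair_word bs)"
  shows "the_normal_form n w = (map fst bs, map snd bs)"
  unfolding the_normal_form_def
proof (rule the_equality)
  show "normal_form n w (fst (map fst bs, map snd bs)) (snd (map fst bs, map snd bs))"
    using assms by (simp add: normal_form_iff_staircase zip_map_fst_snd)
next
  fix p assume p: "normal_form n w (fst p) (snd p)"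
  let ?cs = "zip (fst p) (snd p)"
  have "staircase ?cs" "word_perm (stair_word ?cs) = w" and len: "length (fst p) = length (snd p)"
    using p by (auto simp: normal_form_iff_staircase reduced_word_def)
  moreover have "word_perm (stair_word bs) = w"
    using assms(2) by (simp add: reduced_word_def)
  ultimately have "?cs = bs"
    using assms(1) by (intro staircase_unique) simp_all
  then show "p = (map fst bs, map snd bs)"
    using len by (auto simp: prod_eq_iff)
qed

lemma fully_commutative_staircase:
  assumes "w \<in> fully_commutative n"
  obtains bs where "staircase bs" "reduced_word n w (stair_word bs)"
    "I_set n w = fst ` set bs" "J_set n w = snd ` set bs"
proof -
  obtain us where us: "reduced_word n w us"
    using assms reduced_word_exists unfolding fully_commutative_def by blast
  with braid_free_staircase braid_free_if_fully_commutative[OF assms]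
  obtain bs where bs: "staircase bs" "us \<approx> stair_word bs" by blast
  with us have red: "reduced_word n w (stair_word bs)" using comm_equiv_reduced by blast
  show thesis
    using that[OF bs(1) red] the_normal_form_eq[OF bs(1) red] by (simp add: I_set_def J_set_def)
qed

lemma fully_commutative_determined:
  assumes "v \<in> fully_commutative n" "w \<in> fully_commutative n"
    "I_set n v = I_set n w" "J_set n v = J_set n w"
  shows "v = w"
proof -
  obtain bs where bs: "staircase bs" "reduced_word n v (stair_word bs)"
    "I_set n v = fst ` set bs" "J_set n v = snd ` set bs"
    using assms(1) by (rule fully_commutative_staircase)
  obtain cs where cs: "staircase cs" "reduced_word n w (stair_word cs)"
    "I_set n w = fst ` set cs" "J_set n w = snd ` set cs"
    using assms(2) by (rule fully_commutative_staircase)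
  have "bs = cs"
    using assms(3,4) bs(3,4) cs(3,4) by (intro staircase_eq_if_corners_eq bs(1) cs(1)) simp_all
  then show ?thesis using bs(2) cs(2) by (simp add: reduced_word_def)
qed

lemma corners_fully_commutative:
  assumes "w \<in> fully_commutative n"
  shows "J_set n w = {k. k < w k}" "I_set n w = {w k - 1 | k. k < w k}"
proof -
  obtain bs where bs: "staircase bs" "reduced_word n w (stair_word bs)"
    "I_set n w = fst ` set bs" "J_set n w = snd ` set bs"
    using assms by (rule fully_commutative_staircase)
  then have "word_perm (stair_word bs) = w" by (simp add: reduced_word_def)
  from staircase_corners[OF bs(1) this] bs(3,4)
  show "J_set n w = {k. k < w k}" "I_set n w = {w k - 1 | k. k < w k}" by simp_all
qed

text \<open>A tight word is reduced, every reduced word of the same permutation is tight as well, hence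
  braid-free, hence equivalent to the one staircase word of that permutation.\<close>

lemma fully_commutative_if_tight:
  assumes "finite S" "set us \<subseteq> {1..n}" "ascent S (word_perm us) = length us"
  shows "word_perm us \<in> fully_commutative n"
  unfolding fully_commutative_def
proof (intro CollectI conjI allI impI)
  let ?w = "word_perm us"
  show "?w \<in> Sym n" by (rule word_perm_Sym[OF assms(2)])
  fix vs vs' assume red: "reduced_word n ?w vs" "reduced_word n ?w vs'"
  have stair: "\<exists>bs. staircase bs \<and> vs \<approx> stair_word bs" if "reduced_word n ?w vs" for vs
  proof -
    have "length vs \<le> length us" using reduced_word_le[OF that assms(2)] by simp
    moreover have "word_perm vs = ?w" using that by (simp add: reduced_word_def)
    ultimately have "ascent S (word_perm vs) = length vs"
      using ascent_word_le[OF assms(1), of vs] assms(3) by simp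
    then show ?thesis using braid_free_staircase braid_free_if_tight[OF assms(1)] by blast
  qed
  obtain bs cs where *: "staircase bs" "vs \<approx> stair_word bs" "staircase cs" "vs' \<approx> stair_word cs"
    using stair[OF red(1)] stair[OF red(2)] by blast
  have "word_perm (stair_word bs) = ?w" "word_perm (stair_word cs) = ?w"
    using * red comm_equiv_invariants(1) by (auto simp: reduced_word_def)
  then have "bs = cs"
    using *(1,3) by (intro staircase_unique) simp_all
  then show "vs \<approx> vs'" using * comm_equiv_sym rtranclp_trans by metis
qed

section \<open>Products of transpositions\<close>

definition transp_product :: "nat \<Rightarrow> ('a \<Rightarrow> 'a) \<Rightarrow> bool" where
  "transp_product k f \<longleftrightarrow>
     (\<exists>ps. length ps = k \<and> set ps \<subseteq> {transpose a b | a b. a \<noteq> b} \<and> comp_list ps = f)"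

lemma transp_product_comp:
  assumes "transp_product k f" "transp_product l g"
  shows "transp_product (k + l) (f \<circ> g)"
proof -
  obtain ps qs where "length ps = k" "set ps \<subseteq> {transpose a b | a b. a \<noteq> b}" "comp_list ps = f"
    "length qs = l" "set qs \<subseteq> {transpose a b | a b. a \<noteq> b}" "comp_list qs = g"
    using assms unfolding transp_product_def by blast
  then show ?thesis
    unfolding transp_product_def by (intro exI[of _ "ps @ qs"]) simp
qed

lemma transpose_eq_if_moved:
  assumes "t = transpose c d" "t a \<noteq> a"
  shows "t = transpose a (t a)"
proof -
  have "a = c \<or> a = d" using assms by (auto simp: transpose_def split: if_splits)
  then show ?thesis using assms(1) by (auto simp: transpose_commute)
qed

lemma transpose_conjugate:
  assumes "t = transpose c d" "c \<noteq> d" "b \<noteq> a" "t b \<noteq> a"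
  shows "\<exists>p q. p \<noteq> q \<and> transpose a (t b) \<circ> t \<circ> transpose a b = transpose p q"
proof (cases "t a = a")
  case True
  have "t \<circ> transpose a b = transpose (t a) (t b) \<circ> t"
    using bij_is_inj[OF bij_transpose, of c d]
    by (auto simp: assms(1) fun_eq_iff transpose_def inj_eq)
  then have "transpose a (t b) \<circ> t \<circ> transpose a b =
      transpose a (t b) \<circ> transpose a (t b) \<circ> t"
    unfolding comp_assoc by (simp only: True)
  then show ?thesis using assms(1,2) by auto
next
  case False
  define e where "e = t a"
  have t: "t = transpose a e" and e: "e \<noteq> a"
    using transpose_eq_if_moved[OF assms(1) False] False unfolding e_def .
  have "b \<noteq> e" using assms(4) by (auto simp: t)
  then have "transpose a (t b) \<circ> t \<circ> transpose a b = transpose b e"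
    using assms(3) e by (auto simp: t fun_eq_iff transpose_def)
  with \<open>b \<noteq> e\<close> show ?thesis by blast
qed

text \<open>The transposition that carries the image of \<open>a\<close> back to \<open>a\<close> is always worth one factor:
  conjugation moves it past the factors until one of them absorbs it.\<close>

lemma transp_product_split:
  assumes "transp_product k f" "f a \<noteq> a"
  shows "\<exists>l. k = Suc l \<and> transp_product l (transpose a (f a) \<circ> f)"
proof -
  let ?T = "{transpose a b | a b :: 'a. a \<noteq> b}"
  have "\<exists>qs. Suc (length qs) = length ps \<and> set qs \<subseteq> ?T \<and> comp_list qs = transpose a (f a) \<circ> f"
    if "set ps \<subseteq> ?T" "comp_list ps = f" "f a \<noteq> a" for ps f
    using that
  proof (induction ps arbitrary: f)
    case (Cons t ps)
    define g where "g = comp_list ps"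
    define b where "b = g a"
    obtain c d where t: "t = transpose c d" "c \<noteq> d"
      using Cons.prems(1) by auto
    have f: "f = t \<circ> g" using Cons.prems(2) unfolding comp_list_simps g_def by (rule sym)
    then have fa: "f a = t b" by (simp add: b_def)
    have ps: "set ps \<subseteq> ?T" using Cons.prems(1) by simp
    show ?case
    proof (cases "b = a")
      case True
      have "t = transpose a (t a)"
        using Cons.prems(3) unfolding fa True by (rule transpose_eq_if_moved[OF t(1)])
      then have "transpose a (t a) \<circ> t = id" by (metis transpose_comp_involutory)
      then have "transpose a (t a) \<circ> t \<circ> g = g" by (metis id_comp)
      then have "comp_list ps = transpose a (f a) \<circ> f"
        unfolding fa True unfolding f g_def by (simp only: comp_assoc)
      with ps show ?thesis by (intro exI[of _ ps]) simp
    next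
      case False
      then obtain qs where qs: "Suc (length qs) = length ps" "set qs \<subseteq> ?T"
        "comp_list qs = transpose a b \<circ> g"
        using Cons.IH[OF ps g_def[symmetric]] unfolding b_def by blast
      obtain p q where t': "p \<noteq> q" "transpose a (t b) \<circ> t \<circ> transpose a b = transpose p q"
        using transpose_conjugate[OF t False] Cons.prems(3) unfolding fa by blast
      have "comp_list (transpose p q # qs) =
          transpose a (t b) \<circ> t \<circ> (transpose a b \<circ> transpose a b) \<circ> g"
        unfolding comp_list_simps qs(3) t'(2)[symmetric] by (simp only: comp_assoc)
      also have "\<dots> = transpose a (f a) \<circ> f"
        unfolding fa transpose_comp_involutory unfolding f by (simp only: comp_assoc comp_id)
      finally show ?thesis
        using qs(1,2) t'(1) by (intro exI[of _ "transpose p q # qs"]) auto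
    qed
  qed simp
  moreover obtain ps where "length ps = k" "set ps \<subseteq> ?T" "comp_list ps = f"
    using assms(1) unfolding transp_product_def by blast
  ultimately obtain qs where "Suc (length qs) = k" "set qs \<subseteq> ?T"
    "comp_list qs = transpose a (f a) \<circ> f"
    using assms(2) by blast
  then show ?thesis unfolding transp_product_def by blast
qed

text \<open>Splitting off the steps of a cycle one by one shows that a cycle through \<open>m + 1\<close> points
  costs \<open>m\<close> transpositions.\<close>

lemma chain_length_le:
  assumes "transp_product k f" "distinct ps" "successively (\<lambda>u v. f u = v) ps"
  shows "length ps \<le> Suc k"
  using assms
proof (induction ps arbitrary: k f)
  case (Cons p ps)
  show ?case
  proof (cases ps)
    case (Cons q qs)
    then have q: "f p = q" "q \<noteq> p"
      using Cons.prems(2,3) by (auto simp: Cons)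
    with Cons.prems(1) obtain l where l: "k = Suc l" "transp_product l (transpose p q \<circ> f)"
      using transp_product_split[of k f p] by auto
    have "successively (\<lambda>u v. (transpose p q \<circ> f) u = v) ps"
      unfolding successively_conv_nth
    proof (intro allI impI)
      fix i assume i: "Suc i < length ps"
      then have "f (ps ! i) = ps ! Suc i"
        using successively_nth[OF Cons.prems(3), of "Suc i"] by simp
      moreover have "ps ! Suc i \<noteq> p" "ps ! Suc i \<noteq> q"
        using Cons.prems(2) i by (auto simp: Cons)
      ultimately show "(transpose p q \<circ> f) (ps ! i) = ps ! Suc i" by simp
    qed
    from Cons.IH[OF l(2) _ this] Cons.prems(2) show ?thesis by (simp add: l(1))
  qed simp
qed simp

section \<open>Noncrossing permutations have no crossing arcs\<close>

lemma cox_apply: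
  "cox n v = (if v = 0 \<or> v > n + 1 then v else if v = n + 1 then 1 else Suc v)"
proof -
  have "word_perm [1..<n + 1] v = (if v = 0 \<or> v > n + 1 then v else if v = n + 1 then 1 else Suc v)"
    by (induction n arbitrary: v) (auto simp: simple_refl_apply)
  then show ?thesis unfolding cox_def .
qed

lemma cox_Sym: "cox n \<in> Sym n"
  unfolding cox_def by (intro word_perm_Sym) auto

lemma simple_refl_transpositions:
  assumes "set us \<subseteq> {1..n}"
  shows "set (map simple_refl us) \<subseteq> transpositions n"
proof -
  have "simple_refl i \<in> transpositions n" if "i \<in> {1..n}" for i
    unfolding simple_refl_def transpositions_def using that by (intro CollectI exI conjI) auto
  then show ?thesis using assms by auto
qed

lemma transp_product_word_length:
  assumes "w \<in> Sym n"
  shows "transp_product (word_length (transpositions n) w) w"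
proof -
  obtain us where us: "set us \<subseteq> {1..n}" "word_perm us = w"
    using Sym_eq_word_perm[OF assms] by blast
  from word_length_attained[OF simple_refl_transpositions[OF us(1)]] us(2)
  obtain ps where "length ps = word_length (transpositions n) w" "set ps \<subseteq> transpositions n"
    "comp_list ps = w"
    unfolding word_perm_def by blast
  moreover have "transpositions n \<subseteq> {transpose a b | a b. a \<noteq> b}"
    by (auto simp: transpositions_def)
  ultimately show ?thesis unfolding transp_product_def by blast
qed

lemma word_length_cox_le: "word_length (transpositions n) (cox n) \<le> n"
proof -
  have "word_length (transpositions n) (cox n) \<le> length (map simple_refl [1..<n + 1])"
    unfolding cox_def word_perm_def
    by (intro word_length_le simple_refl_transpositions refl) auto
  then show ?thesis by (simp del: upt_Suc)
qed

lemma successively_upt: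
  assumes "\<And>w. u \<le> w \<Longrightarrow> Suc w < v \<Longrightarrow> f w = Suc w"
  shows "successively (\<lambda>u v. f u = v) [u..<v]"
  using assms by (auto simp: successively_conv_nth)

definition no_crossing :: "(nat \<Rightarrow> nat) \<Rightarrow> bool" where
  "no_crossing x \<longleftrightarrow> (\<forall>a b. a < b \<and> b < x a \<longrightarrow> \<not> x a < x b)"

lemma no_crossingD: "no_crossing x \<Longrightarrow> a < b \<Longrightarrow> b < x a \<Longrightarrow> \<not> x a < x b"
  by (simp add: no_crossing_def)

text \<open>The transposition \<open>(a, e)\<close> cuts the cycle \<open>c\<close> in two and, since \<open>b\<close> and \<open>d\<close> lie on different
  pieces, \<open>(b, d)\<close> joins them again.\<close>

lemma crossing_cycle:
  assumes "1 \<le> a" "a < b" "b < e" "e < d" "d \<le> n + 1"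
    and "transp_product k (transpose b d \<circ> transpose a e \<circ> cox n)"
  shows "n \<le> k"
proof -
  define f where "f = transpose b d \<circ> transpose a e \<circ> cox n"
  \<comment> \<open>the cycle of \<open>f\<close>, started at \<open>a\<close>\<close>
  define ps where "ps = [a..<b] @ [d..<n + 2] @ [1..<a] @ [e..<d] @ [b..<e]"
  have step: "f w = Suc w"
    if "1 \<le> w" "w \<le> n" "Suc w \<notin> {a, b, d, e}" for w
    using that by (auto simp: f_def cox_apply transpose_def)
  have jumps: "f (b - 1) = d" "f (d - 1) = b" "f (e - 1) = a"
    "a \<noteq> 1 \<Longrightarrow> f (a - 1) = e" "f (n + 1) = (if a = 1 then e else 1)"
    using assms(1-5) by (auto simp: f_def cox_apply transpose_def)
  have "successively (\<lambda>u v. f u = v) [a..<b]" "successively (\<lambda>u v. f u = v) [d..<n + 2]"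
    "successively (\<lambda>u v. f u = v) [1..<a]" "successively (\<lambda>u v. f u = v) [e..<d]"
    "successively (\<lambda>u v. f u = v) [b..<e]"
    using assms(1-5) by (intro successively_upt step; auto)+
  moreover have "last [a..<b] = b - 1" "last [d..<n + 2] = n + 1" "a \<noteq> 1 \<Longrightarrow> last [1..<a] = a - 1"
    "last [e..<d] = d - 1" "hd [d..<n + 2] = d" "a \<noteq> 1 \<Longrightarrow> hd [1..<a] = 1" "hd [e..<d] = e"
    "hd [b..<e] = b" "[a..<b] \<noteq> []" "[d..<n + 2] \<noteq> []" "[e..<d] \<noteq> []" "[1..<a] = [] \<longleftrightarrow> a = 1"
    using assms(1-5) by (auto simp: hd_append)
  ultimately have "successively (\<lambda>u v. f u = v) ps"
    unfolding ps_def successively_append_iff using jumps by (auto simp: hd_append)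
  moreover have "distinct ps"
    using assms(1-5) by (auto simp: ps_def)
  ultimately have "length ps \<le> Suc k"
    using assms(6) by (intro chain_length_le) (simp_all only: f_def)
  then show ?thesis using assms(1-5) by (simp add: ps_def del: upt_Suc)
qed

text \<open>Two crossing arcs of \<open>x\<close> would leave \<open>(b, x b) (a, x a) c\<close> with at most \<open>n - 2\<close> factors, too few
  for the long cycle that it is.\<close>

lemma noncrossing_no_crossing:
  assumes "x \<in> noncrossing n"
  shows "no_crossing x"
  unfolding no_crossing_def
proof (intro allI impI notI, elim conjE)
  fix a b assume arcs: "a < b" "b < x a" "x a < x b"
  define T where "T = word_length (transpositions n)"
  have x: "x permutes {1..n + 1}" "x \<in> Sym n" and len: "T x + T (inv x \<circ> cox n) = T (cox n)"
    using assms(1) unfolding noncrossing_def Sym_def abs_le_def T_def by blast+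
  have "inv x \<circ> cox n \<in> Sym n"
    using permutes_compose[OF _ permutes_inv[OF x(1)]] cox_Sym[of n] unfolding Sym_def by blast
  then have rest: "transp_product (T (inv x \<circ> cox n)) (inv x \<circ> cox n)"
    unfolding T_def by (rule transp_product_word_length)
  have "transp_product (T x) x"
    unfolding T_def by (rule transp_product_word_length[OF x(2)])
  then obtain k where k: "T x = Suc k" "transp_product k (transpose a (x a) \<circ> x)"
    using transp_product_split[of "T x" x a] arcs by auto
  define y where "y = transpose a (x a) \<circ> x"
  have "x b \<noteq> x a" "x b \<noteq> a" using arcs by auto
  then have y: "y b = x b" by (simp add: y_def)
  then obtain l where l: "k = Suc l" "transp_product l (transpose b (x b) \<circ> y)"
    using transp_product_split[OF k(2), of b] arcs by (auto simp: y_def)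
  have "transpose b (x b) \<circ> y \<circ> (inv x \<circ> cox n)
      = transpose b (x b) \<circ> transpose a (x a) \<circ> (x \<circ> inv x) \<circ> cox n"
    unfolding y_def by (simp only: comp_assoc)
  also have "\<dots> = transpose b (x b) \<circ> transpose a (x a) \<circ> cox n"
    using permutes_inv_o(1)[OF x(1)] by simp
  finally have cycle: "transp_product (l + T (inv x \<circ> cox n))
      (transpose b (x b) \<circ> transpose a (x a) \<circ> cox n)"
    using transp_product_comp[OF l(2) rest] by simp
  have range: "a \<in> {1..n + 1}" "x b \<in> {1..n + 1}"
    using arcs permutes_not_in[OF x(1), of a] permutes_not_in[OF x(1), of b]
      permutes_in_image[OF x(1), of b] by force+
  have "n \<le> l + T (inv x \<circ> cox n)"
    using range by (intro crossing_cycle[OF _ arcs _ cycle]) simp_all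
  moreover have "T (cox n) \<le> n"
    unfolding T_def by (rule word_length_cox_le)
  ultimately show False using len k(1) l(1) by simp
qed

section \<open>Arcs of noncrossing polygons\<close>

lemma polygon_nth:
  assumes "p \<in> polygons x"
  shows "2 \<le> length p" "sorted_wrt (<) p" "distinct p"
    "j < length p \<Longrightarrow> x (p ! j) = p ! (Suc j mod length p)"
  using assms by (auto simp: polygons_def strict_sorted_iff)

lemma polygon_eq_orbit:
  assumes "p \<in> polygons x" "a \<in> set p"
  shows "set p = range (\<lambda>k. (x ^^ k) a)"
proof -
  note p = polygon_nth[OF assms(1)]
  obtain j where j: "j < length p" "a = p ! j"
    using assms(2) by (auto simp: in_set_conv_nth)
  have pos: "0 < length p" using p(1) by linarith
  have pow: "(x ^^ k) a = p ! ((j + k) mod length p)" for k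
  proof (induction k)
    case (Suc k)
    have "(j + k) mod length p < length p" by (rule mod_less_divisor[OF pos])
    from p(4)[OF this] Suc show ?case by (simp add: mod_Suc_eq)
  qed (use j in simp)
  show ?thesis
  proof (intro equalityI subsetI)
    fix b assume "b \<in> set p"
    then obtain t where t: "t < length p" "b = p ! t"
      by (auto simp: in_set_conv_nth)
    have "j + (length p - j + t) = t + length p" using j(1) by simp
    then have "(j + (length p - j + t)) mod length p = t" using t(1) by simp
    then have "b = (x ^^ (length p - j + t)) a"
      unfolding pow t(2) by simp
    then show "b \<in> range (\<lambda>k. (x ^^ k) a)" by blast
  next
    fix b assume "b \<in> range (\<lambda>k. (x ^^ k) a)"
    moreover have "(j + k) mod length p < length p" for k
      by (rule mod_less_divisor[OF pos])
    ultimately show "b \<in> set p" by (auto simp: pow)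
  qed
qed

lemma polygons_disjoint:
  assumes "p \<in> polygons x" "q \<in> polygons x" "a \<in> set p" "a \<in> set q"
  shows "p = q"
proof -
  have "set p = set q"
    using polygon_eq_orbit[OF assms(1,3)] polygon_eq_orbit[OF assms(2,4)] by simp
  then show ?thesis
    using polygon_nth(2)[OF assms(1)] polygon_nth(2)[OF assms(2)] by (intro strict_sorted_equal) auto
qed

lemma last_in_polygon: "p \<in> polygons x \<Longrightarrow> last p \<in> set p"
  by (cases "p = []") (auto simp: polygons_def)

lemma hd_in_polygon: "p \<in> polygons x \<Longrightarrow> hd p \<in> set p"
  by (cases "p = []") (auto simp: polygons_def)

lemma inj_on_last_polygons: "inj_on last (polygons x)"
  by (intro inj_onI) (metis polygons_disjoint last_in_polygon)

lemma polygon_subset: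
  assumes "x permutes A" "p \<in> polygons x"
  shows "set p \<subseteq> A"
proof
  fix a assume "a \<in> set p"
  then obtain j where j: "j < length p" "a = p ! j"
    by (auto simp: in_set_conv_nth)
  note p = polygon_nth[OF assms(2)]
  have less: "Suc j mod length p < length p" using p(1) by (intro mod_less_divisor) linarith
  moreover have "Suc j mod length p \<noteq> j"
    using j(1) p(1) by (cases "Suc j = length p") auto
  ultimately have "x a \<noteq> a"
    using p(3) p(4)[OF j(1)] j nth_eq_iff_index_eq by metis
  then show "a \<in> A" using permutes_not_in[OF assms(1)] by blast
qed

lemma finite_polygons:
  assumes "x permutes A" "finite A"
  shows "finite (polygons x)"
proof (rule finite_subset)
  show "polygons x \<subseteq> {p. set p \<subseteq> A \<and> distinct p}"
    using polygon_subset[OF assms(1)] polygon_nth(3) by blast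
  show "finite {p. set p \<subseteq> A \<and> distinct p}"
    using assms(2) by (rule finite_subset_distinct)
qed

lemma (in linorder) sorted_key_list_of_set_props:
  assumes "inj_on f S" "finite S"
  shows "set (sorted_key_list_of_set f S) = S"
    and "sorted_wrt (\<lambda>p q. f p < f q) (sorted_key_list_of_set f S)"
proof -
  interpret folding_insort_key "(\<le>)" "(<)" S f
    by standard (rule assms(1))
  show "set (sorted_key_list_of_set f S) = S"
    using set_sorted_key_list_of_set[OF subset_refl assms(2)] .
  show "sorted_wrt (\<lambda>p q. f p < f q) (sorted_key_list_of_set f S)"
    using strict_sorted_key_list_of_set[OF subset_refl] unfolding sorted_wrt_map .
qed

lemma set_cycle_syllables:
  "set (cycle_syllables p) = {(p ! j, p ! Suc j) | j. Suc j < length p}"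
  by (auto simp: cycle_syllables_def set_zip nth_tl)

lemma set_syllables:
  assumes "finite (polygons x)"
  shows "set (syllables x) = {(p ! j, p ! Suc j) | p j. p \<in> polygons x \<and> Suc j < length p}"
  using sorted_key_list_of_set_props(1)[OF inj_on_last_polygons assms]
  by (auto simp: syllables_def set_cycle_syllables)

lemma syllables_increasing:
  assumes "finite (polygons x)" "(i, m) \<in> set (syllables x)"
  shows "i < m"
proof -
  obtain p j where p: "p \<in> polygons x" "Suc j < length p" "i = p ! j" "m = p ! Suc j"
    using assms by (auto simp: set_syllables)
  show "i < m"
    using polygon_nth[OF p(1)] p(2-4) by (auto simp: sorted_wrt_nth_less)
qed

lemma fst_syllables:
  assumes "finite (polygons x)"
  shows "fst ` set (syllables x) = D_set x"
proof (intro equalityI subsetI)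
  fix a assume "a \<in> fst ` set (syllables x)"
  then obtain p j where p: "p \<in> polygons x" "Suc j < length p" "a = p ! j"
    by (auto simp: set_syllables[OF assms])
  then have a: "a \<in> set p" by simp
  have "a \<noteq> last q" if "q \<in> polygons x" for q
  proof
    assume "a = last q"
    then have "q = p" using polygons_disjoint[OF that p(1)] last_in_polygon[OF that] a by simp
    then have "p ! j = p ! (length p - 1)" using \<open>a = last q\<close> p by (cases "p = []") (auto simp: last_conv_nth)
    then show False using polygon_nth(3)[OF p(1)] p(2) by (simp add: nth_eq_iff_index_eq)
  qed
  then show "a \<in> D_set x" using a p(1) by (auto simp: D_set_def Vert_def)
next
  fix a assume "a \<in> D_set x"
  then obtain p j where p: "p \<in> polygons x" "j < length p" "a = p ! j" "a \<noteq> last p"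
    by (auto simp: D_set_def Vert_def in_set_conv_nth)
  have "Suc j \<noteq> length p"
    using p(2-4) last_conv_nth[of p] by (metis diff_Suc_1 length_0_conv not_less_zero)
  then have "(p ! j, p ! Suc j) \<in> set (syllables x)"
    unfolding set_syllables[OF assms] using p(1,2)
    by (intro CollectI exI[of _ p] exI[of _ j]) auto
  then show "a \<in> fst ` set (syllables x)" using p(3) by force
qed

lemma snd_syllables:
  assumes "finite (polygons x)"
  shows "snd ` set (syllables x) = U_set x"
proof (intro equalityI subsetI)
  fix a assume "a \<in> snd ` set (syllables x)"
  then obtain p j where p: "p \<in> polygons x" "Suc j < length p" "a = p ! Suc j"
    by (auto simp: set_syllables[OF assms])
  then have a: "a \<in> set p" by simp
  have "a \<noteq> hd q" if "q \<in> polygons x" for q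
  proof
    assume "a = hd q"
    then have "q = p" using polygons_disjoint[OF that p(1)] hd_in_polygon[OF that] a by simp
    then have "p ! Suc j = p ! 0" using \<open>a = hd q\<close> p by (cases "p = []") (auto simp: hd_conv_nth)
    then show False using polygon_nth(3)[OF p(1)] p(2) by (subst (asm) nth_eq_iff_index_eq) auto
  qed
  then show "a \<in> U_set x" using a p(1) by (auto simp: U_set_def Vert_def)
next
  fix a assume "a \<in> U_set x"
  then obtain p j where p: "p \<in> polygons x" "j < length p" "a = p ! j" "a \<noteq> hd p"
    by (auto simp: U_set_def Vert_def in_set_conv_nth)
  have "j \<noteq> 0"
    using p(2-4) hd_conv_nth[of p] by (metis length_0_conv not_less_zero)
  then obtain l where "j = Suc l" by (cases j) auto
  then have "(p ! l, p ! j) \<in> set (syllables x)"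
    unfolding set_syllables[OF assms] using p(1,2)
    by (intro CollectI exI[of _ p] exI[of _ l]) auto
  then show "a \<in> snd ` set (syllables x)" using p(3) by force
qed

text \<open>The later of two arcs acts first. The relation says that it then neither removes nor adds points
  strictly under the earlier arc and does not end at the right endpoint of the earlier one; it may,
  however, start there, which frees that endpoint.\<close>

definition arc_before :: "nat \<times> nat \<Rightarrow> nat \<times> nat \<Rightarrow> bool" where
  "arc_before a b \<longleftrightarrow>
     (fst b < fst a \<and> snd a < snd b) \<or> snd a \<le> fst b \<or> snd b < fst a"

lemma sorted_wrt_concat_map:
  assumes "\<And>p. p \<in> set ps \<Longrightarrow> sorted_wrt R (f p)"
    and "sorted_wrt (\<lambda>p q. \<forall>a \<in> set (f p). \<forall>b \<in> set (f q). R a b) ps"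
  shows "sorted_wrt R (concat (map f ps))"
  using assms by (induction ps) (auto simp: sorted_wrt_append)

text \<open>An arc of the later polygon \<open>q\<close> cannot sit below an arc of \<open>p\<close>: since \<open>q\<close> ends to the right
  of \<open>p\<close>, it would have to leave that arc again, through a crossing.\<close>

lemma arcs_of_polygons_before:
  assumes nc: "no_crossing x"
    and p: "p \<in> polygons x" and q: "q \<in> polygons x" and less: "last p < last q"
    and j: "Suc j < length p" and l: "Suc l < length q"
  shows "arc_before (p ! j, p ! Suc j) (q ! l, q ! Suc l)"
proof (rule ccontr)
  assume not: "\<not> ?thesis"
  note pp = polygon_nth[OF p] and qq = polygon_nth[OF q]
  have disj: "a \<noteq> b" if "a \<in> set p" "b \<in> set q" for a b
    using polygons_disjoint[OF p q] that less by blast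
  define i m i' m' where defs: "i = p ! j" "m = p ! Suc j" "i' = q ! l" "m' = q ! Suc l"
  have x: "x i = m" "x i' = m'" and up: "i < m" "i' < m'"
    using pp(2) qq(2) pp(4)[of j] qq(4)[of l] j l by (auto simp: defs sorted_wrt_nth_less)
  have mem: "i \<in> set p" "m \<in> set p" "i' \<in> set q" "m' \<in> set q"
    using j l by (simp_all add: defs)
  have neq: "i \<noteq> i'" "i \<noteq> m'" "m \<noteq> i'" "m \<noteq> m'"
    using disj mem by blast+
  have pos: "\<not> (i' < i \<and> m < m')" "i' < m" "i < m'"
    using not neq by (auto simp: arc_before_def simp flip: defs)
  show False
  proof (cases "i' < i")
    case True
    then have "m' < m" using pos(1) neq(4) by simp
    then show False using no_crossingD[OF nc, of i' i] True pos(3) x by simp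
  next
    case False
    then have "i < i'" using neq(1) by simp
    then have "m' < m" using no_crossingD[OF nc, of i i'] pos(2) x neq(4) by linarith
    have "m \<le> last p"
    proof (cases "Suc j = length p - 1")
      case True
      then show ?thesis using j last_conv_nth[of p] by (cases "p = []") (auto simp: defs)
    next
      case False
      then have "p ! Suc j < p ! (length p - 1)"
        using j pp(2) by (intro sorted_wrt_nth_less[of "(<)"]) auto
      then show ?thesis using j last_conv_nth[of p] by (cases "p = []") (auto simp: defs)
    qed
    then have "m < q ! (length q - 1)"
      using less l last_conv_nth[of q] by (cases "q = []") auto
    define t where "t = (LEAST t. m < q ! t)"
    have t: "m < q ! t" "t \<le> length q - 1"
      unfolding t_def using \<open>m < q ! (length q - 1)\<close> by (auto intro: LeastI Least_le)
    have "Suc l < t"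
    proof (rule ccontr)
      assume "\<not> Suc l < t"
      then have "t = Suc l \<or> t < Suc l" by auto
      then have "q ! t \<le> q ! Suc l"
        using sorted_wrt_nth_less[OF qq(2), of t "Suc l"] l by auto
      then show False using t(1) \<open>m' < m\<close> by (simp add: defs)
    qed
    then obtain u where u: "t = Suc u" "l < u" by (cases t) auto
    have "\<not> m < q ! u" using not_less_Least[of u "\<lambda>t. m < q ! t"] u(1) by (simp add: t_def)
    moreover have "q ! u \<in> set q" using t(2) u l by simp
    ultimately have "q ! u < m" using disj[OF mem(2)] by fastforce
    moreover have "i < q ! u"
      using sorted_wrt_nth_less[OF qq(2), of l u] t(2) u l \<open>i < i'\<close> unfolding defs by linarith
    moreover have "x (q ! u) = q ! t"
      using qq(4)[of u] t(2) u l by auto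
    ultimately show False using no_crossingD[OF nc, of i "q ! u"] x(1) t(1) by simp
  qed
qed

lemma syllables_sorted:
  assumes nc: "no_crossing x" and "finite (polygons x)"
  shows "sorted_wrt arc_before (syllables x)"
proof -
  let ?ps = "sorted_key_list_of_set last (polygons x)"
  note ps = sorted_key_list_of_set_props[OF inj_on_last_polygons assms(2)]
  have "sorted_wrt (\<lambda>p q. \<forall>a \<in> set (cycle_syllables p). \<forall>b \<in> set (cycle_syllables q).
      arc_before a b) ?ps"
    by (rule sorted_wrt_mono_rel[OF _ ps(2)])
      (auto simp: ps(1) set_cycle_syllables intro!: arcs_of_polygons_before[OF nc])
  moreover have "sorted_wrt arc_before (cycle_syllables p)" if "p \<in> set ?ps" for p
  proof -
    have "sorted_wrt (<) p" using polygon_nth(2) that ps(1) by blast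
    moreover have "p ! Suc j \<le> p ! k" if "j < k" "k < length p" for j k
      using sorted_wrt_nth_less[OF \<open>sorted_wrt (<) p\<close>, of "Suc j" k] that by (cases "k = Suc j") auto
    ultimately show ?thesis
      by (auto simp: sorted_wrt_iff_nth_less cycle_syllables_def arc_before_def nth_tl)
  qed
  ultimately show ?thesis
    unfolding syllables_def by (intro sorted_wrt_concat_map)
qed

section \<open>The action of a word built from arcs\<close>

definition arc_block :: "nat set \<Rightarrow> nat \<times> nat \<Rightarrow> nat list" where
  "arc_block D a = filter (\<lambda>k. k \<notin> D) (rev [fst a + 1..<snd a]) @ filter (\<lambda>k. k \<in> D) [fst a..<snd a]"

definition arcs_word :: "nat set \<Rightarrow> (nat \<times> nat) list \<Rightarrow> nat list" where
  "arcs_word D as = concat (map (arc_block D) as)"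

lemma w_word_eq_arcs_word:
  "map letter_index (w_word x) = arcs_word (fst ` set (syllables x)) (syllables x)"
proof -
  have "map letter_index (filter (kept x) (syllable_word a)) = arc_block (fst ` set (syllables x)) a" for a
    by (cases a) (simp add: arc_block_def filter_map o_def is_center_def)
  then show ?thesis
    by (simp add: w_word_def m_word_def arcs_word_def filter_concat map_concat o_def)
qed

lemma set_arc_block: "set (arc_block D a) \<subseteq> {fst a..<snd a}"
  by (auto simp: arc_block_def)

text \<open>Lengthening the arc by one appends its new last letter \<open>m\<close> to the block if \<open>m\<close> is a center
  and puts it in front otherwise; in both cases the points of \<open>D\<close> under the arc move up to the next
  point of \<open>D\<close>, the last one to the end of the arc.\<close>

lemma arc_block_action:
  assumes "i \<in> D" "i < m"
  defines "w \<equiv> word_perm (arc_block D (i, m))"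
  shows "w ` (D \<inter> {i..<m}) = insert m (D \<inter> {i<..<m})"
    and "\<forall>v \<in> D \<inter> {i..<m}. v < w v"
    and "length (arc_block D (i, m)) = m - i"
proof -
  have "word_perm (arc_block D (i, m)) ` (D \<inter> {i..<m}) = insert m (D \<inter> {i<..<m}) \<and>
      (\<forall>v \<in> D \<inter> {i..<m}. v < word_perm (arc_block D (i, m)) v) \<and>
      length (arc_block D (i, m)) = m - i"
    using Suc_leI[OF assms(2)]
  proof (induction m rule: dec_induct)
    case base
    have "arc_block D (i, Suc i) = [i]" using assms(1) by (simp add: arc_block_def)
    moreover have "D \<inter> {i..<Suc i} = {i}" "D \<inter> {i<..<Suc i} = {}" using assms(1) by auto
    ultimately show ?case by (simp add: simple_refl_apply)
  next
    case (step m)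
    let ?w = "word_perm (arc_block D (i, m))"
    have im: "i < m" using step.hyps(1) by simp
    have image: "?w ` (D \<inter> {i..<m}) = insert m (D \<inter> {i<..<m})"
      and up: "\<And>v. v \<in> D \<inter> {i..<m} \<Longrightarrow> v < ?w v"
      and len: "length (arc_block D (i, m)) = m - i"
      using step.IH by auto
    show ?case
    proof (cases "m \<in> D")
      case True
      have block: "arc_block D (i, Suc m) = arc_block D (i, m) @ [m]"
        using True im by (simp add: arc_block_def)
      have end_fixed: "?w (Suc m) = Suc m"
        using set_arc_block[of D "(i, m)"] by (intro word_perm_fixes) auto
      have old: "word_perm (arc_block D (i, Suc m)) v = ?w v" if "v \<in> {i..<m}" for v
        using that by (simp add: block simple_refl_apply)
      have new: "word_perm (arc_block D (i, Suc m)) m = Suc m"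
        by (simp add: block simple_refl_apply end_fixed)
      have S: "D \<inter> {i..<Suc m} = insert m (D \<inter> {i..<m})" using True im by auto
      have "word_perm (arc_block D (i, Suc m)) ` (D \<inter> {i..<m}) = ?w ` (D \<inter> {i..<m})"
        using old by (intro image_cong) auto
      then have "word_perm (arc_block D (i, Suc m)) ` (D \<inter> {i..<Suc m})
          = insert (Suc m) (insert m (D \<inter> {i<..<m}))"
        unfolding S image_insert new image by simp
      moreover have "insert m (D \<inter> {i<..<m}) = D \<inter> {i<..<Suc m}" using True im by auto
      ultimately show ?thesis
        using up old new im len by (auto simp: block less_Suc_eq simp del: word_perm_append)
    next
      case False
      have block: "arc_block D (i, Suc m) = m # arc_block D (i, m)"
        using False im by (simp add: arc_block_def)
      have S: "D \<inter> {i..<Suc m} = D \<inter> {i..<m}" "D \<inter> {i<..<Suc m} = D \<inter> {i<..<m}"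
        using False by (auto simp: less_Suc_eq)
      have "word_perm (arc_block D (i, Suc m)) ` (D \<inter> {i..<Suc m})
          = simple_refl m ` insert m (D \<inter> {i<..<m})"
        unfolding S block word_perm_simps image_comp[symmetric] image ..
      also have "\<dots> = insert (Suc m) (D \<inter> {i<..<Suc m})"
        unfolding S by (auto simp: simple_refl_apply image_iff)
      finally have 1: "word_perm (arc_block D (i, Suc m)) ` (D \<inter> {i..<Suc m}) =
        insert (Suc m) (D \<inter> {i<..<Suc m})" .
      have "v < word_perm (arc_block D (i, Suc m)) v" if v: "v \<in> D \<inter> {i..<Suc m}" for v
      proof -
        have "?w v \<in> insert m (D \<inter> {i<..<m})" using v S(1) image by blast
        then have "?w v \<le> m" by auto
        then show ?thesis
          using up[of v] v unfolding S(1) by (simp add: block simple_refl_apply)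
      qed
      with 1 len im show ?thesis by (simp add: block Suc_diff_le)
    qed
  qed
  then show "w ` (D \<inter> {i..<m}) = insert m (D \<inter> {i<..<m})"
    and "\<forall>v \<in> D \<inter> {i..<m}. v < w v"
    and "length (arc_block D (i, m)) = m - i"
    by (simp_all add: w_def)
qed

text \<open>The arcs act from the last to the first. When the turn of \<open>(i, m)\<close> comes, the points of \<open>D\<close>
  have been carried to a set \<open>S\<close> in which the arcs used so far have replaced their left by their
  right endpoints. All of these arcs lie outside or above \<open>(i, m)\<close>, so \<open>S\<close> still agrees with \<open>D\<close>
  under the arc, while \<open>m\<close> is free; hence the block of \<open>(i, m)\<close> moves points upwards only and
  replaces \<open>i\<close> by \<open>m\<close>.\<close>

lemma arcs_word_action:
  assumes "sorted_wrt arc_before (xs @ as)" "\<forall>(i, m) \<in> set (xs @ as). i < m"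
    and D: "D = fst ` set (xs @ as)"
  defines "w \<equiv> word_perm (arcs_word D as)"
  shows "w ` D = (D - fst ` set as) \<union> snd ` set as \<and> (\<forall>d \<in> D. d \<le> w d) \<and>
    (\<forall>d \<in> fst ` set as. d < w d) \<and> \<Sum>(w ` D) = \<Sum>D + length (arcs_word D as)"
  unfolding w_def using assms(1-3)
proof (induction as arbitrary: xs)
  case Nil
  then show ?case by (simp add: arcs_word_def)
next
  case (Cons a as)
  obtain i m where a: "a = (i, m)" by fastforce
  let ?w = "word_perm (arcs_word D as)" and ?b = "word_perm (arc_block D (i, m))"
  define S where "S = ?w ` D"
  have finD: "finite D" using Cons.prems(3) by simp
  have "i < m" "i \<in> D" using Cons.prems(2,3) by (auto simp: a)
  note block = arc_block_action[OF \<open>i \<in> D\<close> \<open>i < m\<close>]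
  have IH: "S = (D - fst ` set as) \<union> snd ` set as" "\<And>d. d \<in> D \<Longrightarrow> d \<le> ?w d"
    "\<And>d. d \<in> fst ` set as \<Longrightarrow> d < ?w d" "\<Sum>S = \<Sum>D + length (arcs_word D as)"
    using Cons.IH[of "xs @ [a]"] Cons.prems by (auto simp: S_def)
  have later: "(i' < i \<and> m < m') \<or> (m \<le> i' \<and> m < m') \<or> (m' < i \<and> i' < i)"
    if "(i', m') \<in> set as" for i' m'
  proof -
    have "arc_before a (i', m')" "i' < m'"
      using Cons.prems(1,2) that by (auto simp: sorted_wrt_append)
    then show ?thesis using \<open>i < m\<close> by (auto simp: a arc_before_def)
  qed
  have "m \<in> fst ` set as" if m_center: "m \<in> D"
  proof -
    obtain m' where m': "(m, m') \<in> set (xs @ a # as)"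
      using m_center Cons.prems(3) by force
    then have "m < m'" using Cons.prems(2) by fastforce
    moreover have "arc_before (m, m') (i, m)" if "(m, m') \<in> set xs"
      using Cons.prems(1) that by (auto simp: a sorted_wrt_append)
    ultimately have "(m, m') \<notin> set xs" "(m, m') \<noteq> a"
      using \<open>i < m\<close> by (auto simp: a arc_before_def)
    then show ?thesis using m' by force
  qed
  moreover have left: "v \<notin> fst ` set as" if "v \<in> {i..<m}" for v
  proof
    assume "v \<in> fst ` set as"
    then obtain m' where "(v, m') \<in> set as" by auto
    from later[OF this] that show False by auto
  qed
  moreover have right: "v \<notin> snd ` set as" if "v \<in> {i..m}" for v
  proof
    assume "v \<in> snd ` set as"
    then obtain i' where "(i', v) \<in> set as" by auto
    from later[OF this] that show False by auto
  qed
  ultimately have "m \<notin> S" using \<open>i < m\<close> unfolding IH(1) by auto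
  have under: "S \<inter> {i..m} = D \<inter> {i..<m}"
  proof (intro equalityI subsetI)
    fix v assume v: "v \<in> S \<inter> {i..m}"
    then have "v \<noteq> m" "v \<notin> snd ` set as" using \<open>m \<notin> S\<close> right by blast+
    then show "v \<in> D \<inter> {i..<m}" using v unfolding IH(1) by auto
  next
    fix v assume v: "v \<in> D \<inter> {i..<m}"
    then show "v \<in> S \<inter> {i..m}" using left[of v] unfolding IH(1) by auto
  qed
  have outside: "?b v = v" if "v \<notin> {i..m}" for v
    using that set_arc_block[of D "(i, m)"] by (intro word_perm_fixes) auto
  have "?b ` S = ?b ` (S \<inter> {i..m}) \<union> ?b ` (S - {i..m})" by blast
  also have "?b ` (S - {i..m}) = S - {i..m}" using outside by force
  also have "?b ` (S \<inter> {i..m}) \<union> (S - {i..m}) = insert m (S - {i})"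
    unfolding under block(1)
  proof (rule set_eqI)
    fix v
    have "v \<in> S \<inter> {i..m} \<longleftrightarrow> v \<in> D \<inter> {i..<m}" by (simp only: under)
    then show "v \<in> insert m (D \<inter> {i<..<m}) \<union> (S - {i..m}) \<longleftrightarrow> v \<in> insert m (S - {i})"
      using \<open>i < m\<close> by auto
  qed
  finally have image: "?b ` S = insert m (S - {i})" .
  have "i \<in> D \<inter> {i..<m}" using \<open>i \<in> D\<close> \<open>i < m\<close> by simp
  then have "i \<in> S" unfolding under[symmetric] by blast
  have b_up: "v \<le> ?b v" "v = i \<Longrightarrow> v < ?b v" if "v \<in> S" for v
  proof -
    have "v < ?b v" if "v \<in> {i..m}"
    proof -
      have "v \<in> D \<inter> {i..<m}" unfolding under[symmetric] using that \<open>v \<in> S\<close> by blast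
      then show ?thesis using block(2) by blast
    qed
    then show "v \<le> ?b v" "v = i \<Longrightarrow> v < ?b v"
      using outside[of v] \<open>i < m\<close> by (cases "v \<in> {i..m}"; simp)+
  qed
  have comp: "word_perm (arcs_word D (a # as)) d = ?b (?w d)" for d
    by (simp add: a arcs_word_def)
  have full: "word_perm (arcs_word D (a # as)) ` D = insert m (S - {i})"
    using image unfolding S_def image_image comp .
  have "i \<notin> snd ` set as" using right \<open>i < m\<close> by simp
  then have endpoints: "insert m (S - {i}) = (D - fst ` set (a # as)) \<union> snd ` set (a # as)"
    unfolding IH(1) a list.simps image_insert fst_conv snd_conv by blast
  have weak: "d \<le> ?b (?w d)" if "d \<in> D" for d
    using order_trans[OF IH(2)[OF that] b_up(1)] that unfolding S_def by blast
  have strict: "d < ?b (?w d)" if "d \<in> fst ` set (a # as)" for d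
  proof -
    have "d \<in> D" using that Cons.prems(3) by auto
    then have S: "?w d \<in> S" "d \<le> ?w d" using IH(2) by (auto simp: S_def)
    show ?thesis
    proof (cases "d < ?w d")
      case True
      then show ?thesis using b_up(1)[OF S(1)] by simp
    next
      case False
      then have "?w d = d" using S(2) by simp
      moreover have "d = i" using that False IH(3)[of d] by (auto simp: a)
      ultimately show ?thesis using b_up(2)[OF S(1)] by simp
    qed
  qed
  have total: "\<Sum>(insert m (S - {i})) = \<Sum>D + length (arcs_word D (a # as))"
  proof -
    have "finite S" using finD by (simp add: S_def)
    then have "\<Sum>S = i + \<Sum>(S - {i})" "\<Sum>(insert m (S - {i})) = m + \<Sum>(S - {i})"
      using \<open>i \<in> S\<close> \<open>m \<notin> S\<close> by (simp_all add: sum.remove)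
    moreover have "length (arcs_word D (a # as)) = (m - i) + length (arcs_word D as)"
      using block(3) by (simp add: arcs_word_def a)
    ultimately show ?thesis using IH(4) \<open>i < m\<close> by simp
  qed
  show ?case unfolding full unfolding comp by (intro conjI ballI endpoints weak strict total)
qed

section \<open>Zinno's map and the map of the vertex sets agree\<close>

lemma zinno_corners:
  assumes "x \<in> noncrossing n"
  shows "zinno x \<in> fully_commutative n" "J_set n (zinno x) = D_set x"
    "int ` I_set n (zinno x) = shift (int ` U_set x) (-1)"
proof -
  have perm: "x permutes {1..n + 1}"
    using assms by (simp add: noncrossing_def Sym_def)
  have fin: "finite (polygons x)" by (rule finite_polygons[OF perm]) simp
  let ?A = "syllables x" and ?D = "D_set x"
  define us where "us = arcs_word ?D ?A"
  have zinno: "zinno x = word_perm us"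
    unfolding zinno_def w_word_eq_arcs_word fst_syllables[OF fin] us_def ..
  have sorted: "sorted_wrt arc_before ([] @ ?A)"
    unfolding append_Nil by (rule syllables_sorted[OF noncrossing_no_crossing[OF assms] fin])
  have arcs: "\<forall>(i, m) \<in> set ([] @ ?A). i < m" using syllables_increasing[OF fin] by auto
  have D: "?D = fst ` set ([] @ ?A)" using fst_syllables[OF fin] by simp
  note action = arcs_word_action[OF sorted arcs D, folded us_def]
  have image: "word_perm us ` ?D = U_set x"
    using action unfolding snd_syllables[OF fin] fst_syllables[OF fin] by simp
  have finD: "finite ?D" unfolding D by simp
  have up: "d < word_perm us d" if "d \<in> ?D" for d
    using action that unfolding fst_syllables[OF fin] by blast
  have tight: "ascent ?D (word_perm us) = length us"
  proof -
    have "\<Sum>(word_perm us ` ?D) = (\<Sum>d\<in>?D. word_perm us d)"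
      using inj_on_subset[OF bij_is_inj[OF bij_word_perm]] by (subst sum.reindex) auto
    moreover have "\<Sum>(word_perm us ` ?D) = \<Sum>?D + length us"
      using action by blast
    moreover have "ascent ?D (word_perm us) = (\<Sum>d\<in>?D. word_perm us d) - \<Sum>?D"
      unfolding ascent_def using up by (intro sum_subtractf_nat) (simp add: less_imp_le)
    ultimately show ?thesis by linarith
  qed
  have verts: "1 \<le> i \<and> m \<le> n + 1" if "(i, m) \<in> set ?A" for i m
  proof -
    obtain p j where p: "p \<in> polygons x" "Suc j < length p" "i = p ! j" "m = p ! Suc j"
      using \<open>(i, m) \<in> set ?A\<close> by (auto simp: set_syllables[OF fin])
    then have "i \<in> set p" "m \<in> set p" by simp_all
    then show ?thesis using polygon_subset[OF perm p(1)] by auto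
  qed
  have "set us \<subseteq> {1..n}"
  proof
    fix k assume "k \<in> set us"
    then obtain i m where "(i, m) \<in> set ?A" "k \<in> {i..<m}"
      using set_arc_block by (fastforce simp: us_def arcs_word_def)
    then show "k \<in> {1..n}" using verts by fastforce
  qed
  from fully_commutative_if_tight[OF finD this tight]
  show fc: "zinno x \<in> fully_commutative n" unfolding zinno .
  have exc: "{k. k < zinno x k} = ?D"
    unfolding zinno by (rule excedances_if_tight[OF finD tight up])
  show "J_set n (zinno x) = ?D"
    using corners_fully_commutative(1)[OF fc] exc by simp
  have "I_set n (zinno x) = (\<lambda>k. zinno x k - 1) ` {k. k < zinno x k}"
    using corners_fully_commutative(2)[OF fc] by auto
  also have "\<dots> = (\<lambda>u. u - 1) ` U_set x"
    unfolding exc unfolding image[symmetric] image_image zinno ..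
  finally have I: "I_set n (zinno x) = (\<lambda>u. u - 1) ` U_set x" .
  have "1 \<le> u" if "u \<in> U_set x" for u
    using that up unfolding image[symmetric] by fastforce
  then show "int ` I_set n (zinno x) = shift (int ` U_set x) (-1)"
    unfolding I shift_def image_image by (intro image_cong) (auto simp: of_nat_diff)
qed

theorem proposition3p11:
  fixes n :: nat
  assumes "n \<ge> 1"
  shows "\<forall>x \<in> noncrossing n. phi n x = zinno x"
proof
  fix x assume "x \<in> noncrossing n"
  note zinno = zinno_corners[OF this]
  show "phi n x = zinno x"
    unfolding phi_def
  proof (rule the_equality)
    fix w assume w: "w \<in> fully_commutative n \<and> J_set n w = D_set x \<and>
      int ` I_set n w = shift (int ` U_set x) (-1)"
    then have "int ` I_set n w = int ` I_set n (zinno x)" using zinno(3) by simp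
    then have "I_set n w = I_set n (zinno x)" by (simp add: inj_image_eq_iff)
    with w zinno show "w = zinno x" by (intro fully_commutative_determined) auto
  qed (use zinno in simp)
qed

end
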